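(* Let $n$ be a positive integer, let $g$ be a polynomial on $\mathbb{C}^n$, and suppose that $u$ is an entire function on $\mathbb{C}^n$ satisfying $$u_{z_1}u_{z_2}\cdots u_{z_n}=e^{g}.$$ Let $I=\{1,\dots,n\}$, and let $J$, $\chi=I\setminus J$ and $t$ be as defined in the context (for this $u$). Then the following assertions hold. (1) If $\sharp J=0$ and $t=1$, then there are complex constants $A_1,\dots,A_n$ with $A_1\cdots A_n=1$ and entire functions $G,f$ of one complex variable with $f'=e^{G/n}$ such that $$g(z)=G(A_1z_1+A_2z_2+\cdots+A_nz_n),\qquad u(z)=f(A_1z_1+A_2z_2+\cdots+A_nz_n).$$ (2) If $0<\sharp J<n$, $J=\{\tau_1,\dots,\tau_\nu\}$ with $\nu=\sharp J$, $\chi=I\setminus J=\{\tau_{\nu+1},\dots,\tau_n\}$ and $t=1$, then there are entire functions $g_1,\dots,g_\nu,g_{\nu+1}$ and $f$ of one complex variable with $f'=e^{g_{\nu+1}/(n-\nu)}$, complex constants $A_{\tau_j}$ $(j=\nu+1,\dots,n)$ and an integer $k_0$ such that $$g(z)=\sum_{i=1}^\nu g_i(z_{\tau_i})+g_{\nu+1}\left(A_{\tau_{\nu+1}}z_{\tau_{\nu+1}}+\cdots+A_{\tau_n}z_{\tau_n}\right)+2k_0\pi \sqrt{-1},$$ $$u(z)=\sum_{i=1}^\nu\int e^{g_i(z_{\tau_i})}\,dz_{\tau_i}+f\left(A_{\tau_{\nu+1}}z_{\tau_{\nu+1}}+\cdots+A_{\tau_n}z_{\tau_n}\right).$$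
   Context: An entire function on $\mathbb{C}^n$ is a holomorphic function $\mathbb{C}^n\to\mathbb{C}$; $u_{z_i}=\partial u/\partial z_i$ and $u_{ij}=u_{z_iz_j}$ for $i,j\in I=\{1,2,\dots,n\}$. For a finite set $G$, $\sharp G$ is its number of elements. Given $u$, set $$J=\{i\in I:\ u_{ij}\equiv 0\ \text{for every } j\in I\setminus\{i\}\},\qquad \chi=I\setminus J$$ ($J$ may be empty). Write $u_{z_i}\sim u_{z_j}$ if $u_{ij}\not\equiv 0$ (a symmetric relation). Write $u_{z_i}\approx u_{z_j}$ if $u_{z_i}\sim u_{z_j}$ or there is a finite chain $u_{z_i}\sim u_{z_k}\sim\cdots\sim u_{z_j}$; otherwise write $u_{z_i}\not\approx u_{z_j}$. These relations are understood as relations between the indices $i$ and $j$. When $\sharp J<n$, the set $\chi$ has a partition $\chi=\bigcup_{l=1}^t I_l$ into sets with $\sharp I_l\ge 2$ such that, for $i\in I_\mu$ and $j\in I_\lambda$, $u_{z_i}\approx u_{z_j}$ if $\mu=\lambda$ and $u_{z_i}\not\approx u_{z_j}$ if $\mu\ne\lambda$; the number of blocks of this partition is $t$. (So $t=1$ means $u_{z_i}\approx u_{z_j}$ for all $i,j\in\chi$.) The notation $\int e^{g_i(z_{\tau_i})}\,dz_{\tau_i}$ means some entire antiderivative, in the single variable $z_{\tau_i}$, of $e^{g_i(z_{\tau_i})}$ (the constant of integration being chosen suitably). *)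

theory Defs
  imports "HOL-Complex_Analysis.Complex_Analysis"
begin

text \<open>
  Points of complex \<open>n\<close>-space are vectors of type \<open>complex ^ 'n\<close>, so \<open>n = CARD('n)\<close> and the
  index set is \<open>UNIV :: 'n set\<close>.

  The library's \<open>holomorphic_on\<close> covers one complex variable only. In several variables
  we ask for a Frechet derivative at every point that is complex linear; additivity is
  already part of \<open>has_derivative\<close>, so homogeneity is what remains to be required.
\<close>

definition entire_cn :: "(complex ^ 'n \<Rightarrow> complex) \<Rightarrow> bool" where
  "entire_cn u \<longleftrightarrow>
     (\<forall>z. \<exists>D. (u has_derivative D) (at z) \<and> (\<forall>c v. D (c *s v) = c * D v))"

definition polynomial_cn :: "(complex ^ 'n \<Rightarrow> complex) \<Rightarrow> bool" where
  "polynomial_cn g \<longleftrightarrow>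
     (\<exists>(M :: ('n \<Rightarrow> nat) set) c. finite M \<and>
        (\<forall>z. g z = (\<Sum>m\<in>M. c m * (\<Prod>i\<in>UNIV. (z $ i) ^ m i))))"

definition partial_deriv :: "'n \<Rightarrow> (complex ^ 'n \<Rightarrow> complex) \<Rightarrow> complex ^ 'n \<Rightarrow> complex" where
  "partial_deriv i u z = deriv (\<lambda>w. u (z + axis i w)) 0"

text \<open>In the subscript notation \<open>u\<^sub>i\<^sub>j\<close> the variable \<open>i\<close> is differentiated first.\<close>

definition partial_deriv2 ::
    "'n \<Rightarrow> 'n \<Rightarrow> (complex ^ 'n \<Rightarrow> complex) \<Rightarrow> complex ^ 'n \<Rightarrow> complex" where
  "partial_deriv2 i j u = partial_deriv j (partial_deriv i u)"

definition isolated_indices :: "(complex ^ 'n \<Rightarrow> complex) \<Rightarrow> 'n set" where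
  "isolated_indices u = {i. \<forall>j. j \<noteq> i \<longrightarrow> (\<forall>z. partial_deriv2 i j u z = 0)}"

definition linked_indices :: "(complex ^ 'n \<Rightarrow> complex) \<Rightarrow> 'n set" where
  "linked_indices u = UNIV - isolated_indices u"

definition adjacent :: "(complex ^ 'n \<Rightarrow> complex) \<Rightarrow> 'n \<Rightarrow> 'n \<Rightarrow> bool" where
  "adjacent u i j \<longleftrightarrow> (\<exists>z. partial_deriv2 i j u z \<noteq> 0)"

definition chained :: "(complex ^ 'n \<Rightarrow> complex) \<Rightarrow> 'n \<Rightarrow> 'n \<Rightarrow> bool" where
  "chained u = (adjacent u)\<^sup>+\<^sup>+"

definition blocks :: "(complex ^ 'n \<Rightarrow> complex) \<Rightarrow> 'n set set" where
  "blocks u =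
     linked_indices u //
       {(i, j). i \<in> linked_indices u \<and> j \<in> linked_indices u \<and> chained u i j}"

definition num_blocks :: "(complex ^ 'n \<Rightarrow> complex) \<Rightarrow> nat" where
  "num_blocks u = card (blocks u)"

text \<open>
  Once adjacency is symmetric (equality of mixed partial derivatives, automatic for entire
  functions), \<open>blocks u\<close> is the partition of the linked indices whose blocks have at least
  two elements and are told apart exactly by \<open>chained u\<close>.
\<close>

lemma blocks_partition:
  fixes u :: "complex ^ 'n \<Rightarrow> complex"
  assumes sym: "symp (adjacent u)"
  shows "partition_on (linked_indices u) (blocks u)"
    and "B \<in> blocks u \<Longrightarrow> card B \<ge> 2"
    and "\<lbrakk>B \<in> blocks u; C \<in> blocks u; i \<in> B; j \<in> C\<rbrakk> \<Longrightarrow> chained u i j \<longleftrightarrow> B = C"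
proof -
  let ?X = "linked_indices u"
  let ?R = "{(i, j). i \<in> ?X \<and> j \<in> ?X \<and> chained u i j}"
  have csym: "chained u j i" if "chained u i j" for i j
    using that unfolding chained_def
  proof (induction rule: tranclp_induct)
    case (base y)
    then show ?case using sympD[OF sym] by blast
  next
    case (step y z)
    then show ?case using sympD[OF sym] by (meson tranclp_into_tranclp2)
  qed
  have ctrans: "chained u i k" if "chained u i j" "chained u j k" for i j k
    using that unfolding chained_def by (rule tranclp_trans)
  have nbr: "\<exists>j. j \<noteq> i \<and> j \<in> ?X \<and> chained u i j" if i: "i \<in> ?X" for i
  proof -
    from i obtain j where j: "j \<noteq> i" "adjacent u i j"
      unfolding linked_indices_def isolated_indices_def adjacent_def by auto
    from sympD[OF sym j(2)] j(1) have "j \<in> ?X"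
      unfolding linked_indices_def isolated_indices_def adjacent_def by auto
    then show ?thesis using j unfolding chained_def by auto
  qed
  have crefl: "chained u i i" if "i \<in> ?X" for i
    using nbr[OF that] csym ctrans by blast
  have eq: "equiv ?X ?R"
    by (rule equivI) (auto simp: refl_on_def intro!: symI transI crefl intro: csym ctrans)
  show "partition_on ?X (blocks u)"
    unfolding blocks_def using eq by (rule partition_on_quotient)
  show "card B \<ge> 2" if "B \<in> blocks u"
  proof -
    from that obtain i where i: "i \<in> ?X" "B = ?R `` {i}"
      unfolding blocks_def by (auto elim: quotientE)
    from nbr[OF i(1)] obtain j where "j \<noteq> i" "j \<in> ?X" "chained u i j" by blast
    then have "{i, j} \<subseteq> B" "card {i, j} = 2" using i crefl by auto
    then show ?thesis by (metis card_mono finite)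
  qed
  show "chained u i j \<longleftrightarrow> B = C" if "B \<in> blocks u" "C \<in> blocks u" "i \<in> B" "j \<in> C"
  proof -
    have "i \<in> ?X" "j \<in> ?X"
      using that in_quotient_imp_subset[OF eq] unfolding blocks_def by blast+
    then show ?thesis
      using quotient_eq_iff[OF eq, of B C i j] that unfolding blocks_def by auto
  qed
qed

end

theory Submission
  imports Defs "HOL-Real_Asymp.Real_Asymp"
begin

text \<open>
  Every \<open>u\<^sub>i = \<partial>u/\<partial>z\<^sub>i\<close> is entire and has no zeros, so \<open>u\<^sub>i = exp p\<^sub>i\<close> with \<open>p\<^sub>i\<close> entire. All of the
  structure follows once \<open>p\<^sub>i - p\<^sub>k\<close> is known to be constant for all linked indices \<open>i\<close>, \<open>k\<close>: the
  \<open>u\<^sub>i\<close> with \<open>i\<close> linked are then multiples \<open>A\<^sub>i V\<close> of one function, so that \<open>u\<close> does not change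
  along linked directions \<open>v\<close> with \<open>\<Sum> A\<^sub>i v\<^sub>i = 0\<close>, while every isolated variable splits off as a
  separate summand.

  Constancy is a growth argument. Equality of the mixed derivatives reads
  \<open>A exp p\<^sub>i = B exp p\<^sub>j\<close> with \<open>A = \<partial>p\<^sub>i/\<partial>z\<^sub>j\<close> and \<open>B = \<partial>p\<^sub>j/\<partial>z\<^sub>i\<close>. If \<open>\<bar>A\<bar>, \<bar>B\<bar> \<le> K\<close> on a ball, then
  \<open>\<bar>A B\<bar> \<le> K\<^sup>2 exp (- \<bar>Re (p\<^sub>i - p\<^sub>j)\<bar>)\<close> there, so \<open>A B\<close> is very small wherever \<open>\<bar>Re (p\<^sub>i - p\<^sub>j)\<bar>\<close> is
  large. When \<open>i\<close> and \<open>j\<close> are adjacent, \<open>A B\<close> does not vanish identically, and Jensen's inequality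
  does not let it be small on average: the mean of \<open>\<bar>Re (p\<^sub>i - p\<^sub>j)\<bar>\<close> over a circle is at most
  \<open>2 log K\<close> plus a constant. Hence \<open>p\<^sub>i - p\<^sub>j\<close> grows at most like the logarithm of the gradients of
  the \<open>p\<^sub>i\<close>. Those gradients are in turn bounded, by Cauchy's estimate, by the differences
  themselves and by \<open>\<Sum> p\<^sub>i\<close> over the linked indices, which is a polynomial up to a constant. A
  function bounded in this way by its own logarithm grows slower than linearly along a sequence
  of radii, and an entire function with this property is constant.

  This plays the part of the lemma on the logarithmic derivative in Nevanlinna theory. The
  one-variable estimate is \<open>growth_from_modulus_times_exp_bound\<close>, the comparison of radii is
  \<open>sublinear_if_bounded_by_own_logarithm\<close>, and the two are combined in
  \<open>connected_logarithms_differ_by_constants\<close>; the resulting normal form of \<open>u\<close> and \<open>g\<close> is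
  \<open>one_block_structure\<close>.
\<close>

section \<open>A Jensen-type growth estimate in one variable\<close>

text \<open>
  Discrete Jensen inequality. The product of the \<open>G (\<zeta> w\<^sup>k)\<close> is a holomorphic function of
  \<open>\<zeta>\<close> with value \<open>G 0 ^ N\<close> at the centre, to which the maximum principle applies;
  taking a product instead of integrating \<open>ln \<bar>G\<bar>\<close> makes the zeros of \<open>G\<close> harmless. The price
  is that the circle points start at some uncontrolled \<open>\<zeta>\<close>.
\<close>
lemma jensen_roots_of_unity:
  fixes G :: "complex \<Rightarrow> complex"
  assumes G: "G holomorphic_on UNIV" and R: "R > 0"
  shows "\<exists>\<zeta>. norm \<zeta> = R \<and> norm (G 0) ^ N \<le> (\<Prod>k<N. norm (G (\<zeta> * w ^ k)))"
proof -
  define P where "P = (\<lambda>z. \<Prod>k<N. G (z * w ^ k))"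
  have Gcomp: "(\<lambda>z. G (z * w ^ k)) holomorphic_on UNIV" for k
    using holomorphic_on_compose_gen[of "\<lambda>z. z * w ^ k" UNIV G UNIV] G
    by (simp add: o_def holomorphic_intros)
  have P: "P holomorphic_on UNIV"
    unfolding P_def by (intro holomorphic_intros Gcomp)
  have cont: "continuous_on S P" for S
    using holomorphic_on_imp_continuous_on[OF P] continuous_on_subset by blast
  have "sphere (0::complex) R \<noteq> {}" using R by simp
  then obtain \<zeta> where \<zeta>: "\<zeta> \<in> sphere 0 R" "\<And>z. z \<in> sphere 0 R \<Longrightarrow> norm (P z) \<le> norm (P \<zeta>)"
    using continuous_attains_sup[OF compact_sphere _ continuous_on_norm[OF cont]] by blast
  have "norm (P 0) \<le> norm (P \<zeta>)"
    by (rule maximum_modulus_frontier[of P "cball 0 R"])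
       (use R \<zeta>(2) in \<open>auto intro: holomorphic_on_subset[OF P] cont\<close>)
  then show ?thesis
    using \<zeta>(1) by (auto simp: P_def norm_power prod_norm)
qed

text \<open>
  Orthogonality of the characters of the cyclic group of order \<open>N\<close>, for exponents that are
  distinct but closer than \<open>N\<close> and hence distinct modulo \<open>N\<close>.
\<close>
lemma root_of_unity_sum:
  fixes m n N :: nat
  defines "w \<equiv> cis (2 * pi / real N)"
  assumes "m \<noteq> n" "m < n + N" "n < m + N"
  shows "(\<Sum>k<N. (w ^ k) ^ m * cnj (w ^ k) ^ n) = 0"
proof -
  have N: "N > 0" using assms by (cases N) auto
  define q where "q = w ^ m * cnj w ^ n"
  have wN: "w ^ N = 1" using N by (simp add: w_def Complex.DeMoivre)
  have ww: "w * cnj w = 1" using complex_norm_square[of w] by (simp add: w_def)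
  have w1: "w ^ j = 1 \<longleftrightarrow> N dvd j" for j
  proof -
    have "w ^ j = exp (2 * of_real pi * \<i> * of_nat j / of_nat N)"
      by (simp add: w_def cis_conv_exp exp_of_nat_mult[symmetric] mult_ac)
    then show ?thesis
      using complex_root_unity_eq[of N j 0] N by (simp add: mod_eq_0_iff_dvd)
  qed
  have q: "(w ^ k) ^ m * cnj (w ^ k) ^ n = q ^ k" for k
    by (simp add: q_def power_mult_distrib flip: power_mult) (simp add: mult.commute)
  have qN: "q ^ N = 1"
  proof -
    have "q ^ N = (w ^ N) ^ m * (cnj (w ^ N)) ^ n"
      by (simp add: q_def power_mult_distrib flip: power_mult) (simp add: mult.commute)
    then show ?thesis by (simp add: wN)
  qed
  have q1: "q \<noteq> 1"
  proof
    assume "q = 1"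
    have qn: "q * w ^ n = w ^ m"
      using ww by (simp add: q_def mult.assoc flip: power_mult_distrib) (simp add: mult.commute)
    have "w ^ n = w ^ m" using qn \<open>q = 1\<close> by simp
    have wne: "w \<noteq> 0" by (simp add: w_def)
    have "w ^ (max m n - min m n) = 1"
      using \<open>w ^ n = w ^ m\<close> wne by (auto simp: max_def min_def power_diff)
    then have "N dvd max m n - min m n" using w1 by blast
    moreover have "max m n - min m n < N" "max m n - min m n > 0" using assms by auto
    ultimately show False by (auto dest: dvd_imp_le)
  qed
  have "(\<Sum>k<N. q ^ k) = 0" using q1 qN by (simp add: geometric_sum)
  then show ?thesis by (simp only: q)
qed

text \<open>
  In the limit this is \<open>c\<^sub>n R\<^sup>n = 1/\<pi> \<integral> Re h(R e\<^sup>i\<^sup>t) e\<^sup>-\<^sup>i\<^sup>n\<^sup>t dt\<close>. The averages over \<open>N\<close> equidistant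
  points recover \<open>c n\<close> from \<open>2 Re h = h + cnj h\<close> up to coefficients of index at least \<open>N - n\<close>,
  whose total contribution tends to \<open>0\<close>. The bound holds uniformly in the position of the
  points, so the uncontrolled starting points of the discrete Jensen inequality do no harm.
\<close>
lemma coeff_bound_by_mean_abs_Re:
  fixes c :: "nat \<Rightarrow> complex"
  assumes sm: "\<And>z. (\<lambda>m. c m * z ^ m) sums h z" and R: "R > 0" and n: "n > 0"
    and mean: "\<And>N. N > 0 \<Longrightarrow>
      \<exists>\<zeta>. norm \<zeta> = R \<and> (\<Sum>k<N. \<bar>Re (h (\<zeta> * cis (2 * pi / real N) ^ k))\<bar>) \<le> s * real N"
  shows "norm (c n) * R ^ n \<le> 2 * s"
proof -
  define a where "a = (\<lambda>m. norm (c m) * R ^ m)"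
  have "summable (\<lambda>m. norm (c m * (of_real R) ^ m))"
    by (rule powser_insidea[of c "of_real (R + 1)"]) (use sums_summable[OF sm] R in auto)
  then have a: "summable a" using R by (simp add: a_def norm_mult norm_power)
  have a0: "a m \<ge> 0" for m using R by (simp add: a_def)
  define t where "t = (\<lambda>K. \<Sum>m. if m < K then 0 else a m)"
  have tsum: "summable (\<lambda>m. if m < K then 0 else a m)" for K
    by (rule summable_comparison_test[OF _ a]) (use a0 in auto)
  have tlim: "t \<longlonglongrightarrow> 0"
  proof -
    have teq: "t = (\<lambda>K. suminf a - (\<Sum>m<K. a m))"
    proof
      fix K
      have "(\<lambda>m. if m \<in> {..<K} then a m else 0) sums (\<Sum>m<K. a m)"
        by (rule sums_If_finite_set) auto
      from sums_diff[OF summable_sums[OF a] this]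
      have "(\<lambda>m. if m < K then 0 else a m) sums (suminf a - (\<Sum>m<K. a m))"
        by (rule sums_cong[THEN iffD1, rotated]) auto
      then show "t K = suminf a - (\<Sum>m<K. a m)" unfolding t_def by (simp add: sums_iff)
    qed
    moreover have "(\<lambda>K. suminf a - (\<Sum>m<K. a m)) \<longlonglongrightarrow> suminf a - suminf a"
      by (intro tendsto_intros summable_LIMSEQ a)
    ultimately show ?thesis by simp
  qed
  \<comment> \<open>for \<open>N > 2n\<close> no index below \<open>N - n\<close> other than \<open>n\<close> is congruent to \<open>\<plusminus>n\<close> modulo \<open>N\<close>\<close>
  have key: "norm (c n) * R ^ n \<le> 2 * s + 2 * t (N - n)" if N: "N > 2 * n" for N
  proof -
    define w where "w = cis (2 * pi / real N)"
    obtain \<zeta> where \<zeta>: "norm \<zeta> = R" "(\<Sum>k<N. \<bar>Re (h (\<zeta> * w ^ k))\<bar>) \<le> s * real N"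
      using mean[of N] N by (auto simp: w_def)
    have nw [simp]: "norm w = 1" by (simp add: w_def)
    define S1 where "S1 = (\<Sum>k<N. h (\<zeta> * w ^ k) * cnj (w ^ k) ^ n)"
    define S2 where "S2 = (\<Sum>k<N. h (\<zeta> * w ^ k) * (w ^ k) ^ n)"
    define e1 where "e1 = (\<lambda>m. \<Sum>k<N. (w ^ k) ^ m * cnj (w ^ k) ^ n)"
    define e2 where "e2 = (\<lambda>m. \<Sum>k<N. (w ^ k) ^ m * (w ^ k) ^ n)"
    have ww: "w ^ k * cnj (w ^ k) = 1" for k
      using complex_norm_square[of "w ^ k"] by (simp add: norm_power)
    have s1: "(\<lambda>m. c m * \<zeta> ^ m * e1 m) sums S1"
    proof -
      have "(\<lambda>m. \<Sum>k<N. (c m * (\<zeta> * w ^ k) ^ m) * cnj (w ^ k) ^ n) sums S1"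
        unfolding S1_def by (intro sums_sum sums_mult2 sm)
      then show ?thesis
        by (simp add: e1_def sum_distrib_left power_mult_distrib mult_ac)
    qed
    have s2: "(\<lambda>m. c m * \<zeta> ^ m * e2 m) sums S2"
    proof -
      have "(\<lambda>m. \<Sum>k<N. (c m * (\<zeta> * w ^ k) ^ m) * (w ^ k) ^ n) sums S2"
        unfolding S2_def by (intro sums_sum sums_mult2 sm)
      then show ?thesis
        by (simp add: e2_def sum_distrib_left power_mult_distrib mult_ac)
    qed
    have e1n: "e1 n = of_nat N"
      by (simp only: e1_def power_mult_distrib[symmetric] ww) simp
    have e10: "e1 m = 0" if "m < N - n" "m \<noteq> n" for m
      unfolding e1_def w_def by (rule root_of_unity_sum) (use that N in auto)
    have e20: "e2 m = 0" if "m < N - n" for m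
    proof -
      have "(\<Sum>k<N. (w ^ k) ^ (m + n) * cnj (w ^ k) ^ 0) = 0"
        unfolding w_def by (rule root_of_unity_sum) (use that N n in auto)
      then show ?thesis by (simp add: e2_def power_add)
    qed
    have e1b: "norm (e1 m) \<le> N" for m
      unfolding e1_def by (rule order_trans[OF norm_sum]) (simp add: norm_mult norm_power)
    have e2b: "norm (e2 m) \<le> N" for m
      unfolding e2_def by (rule order_trans[OF norm_sum]) (simp add: norm_mult norm_power)
    have ab: "norm (c m * \<zeta> ^ m * x) \<le> real N * a m" if "norm x \<le> N" for m x
      using mult_left_mono[OF that, of "a m"] a0[of m]
      by (simp add: a_def norm_mult norm_power \<zeta>(1) mult_ac)
    have tN: "(\<lambda>m. real N * (if m < N - n then 0 else a m)) sums (real N * t (N - n))"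
      unfolding t_def by (intro sums_mult summable_sums tsum)
    have b1: "norm (S1 - c n * \<zeta> ^ n * of_nat N) \<le> real N * t (N - n)"
    proof -
      have "(\<lambda>m. if m = n then c m * \<zeta> ^ m * e1 m else 0) sums (c n * \<zeta> ^ n * e1 n)"
        by (rule sums_single)
      from sums_diff[OF s1 this]
      have *: "(\<lambda>m. if m < N - n then 0 else c m * \<zeta> ^ m * e1 m) sums
               (S1 - c n * \<zeta> ^ n * of_nat N)"
        unfolding e1n by (rule sums_cong[THEN iffD1, rotated]) (use e10 N in auto)
      show ?thesis
        using norm_suminf_le[OF _ sums_summable[OF tN],
            of "\<lambda>m. if m < N - n then 0 else c m * \<zeta> ^ m * e1 m"] ab[OF e1b]
          sums_unique[OF *] sums_unique[OF tN] by auto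
    qed
    have b2: "norm S2 \<le> real N * t (N - n)"
    proof -
      have *: "(\<lambda>m. if m < N - n then 0 else c m * \<zeta> ^ m * e2 m) sums S2"
        using s2 by (rule sums_cong[THEN iffD1, rotated]) (use e20 in auto)
      show ?thesis
        using norm_suminf_le[OF _ sums_summable[OF tN],
            of "\<lambda>m. if m < N - n then 0 else c m * \<zeta> ^ m * e2 m"] ab[OF e2b]
          sums_unique[OF *] sums_unique[OF tN] by auto
    qed
    have "S1 + cnj S2 = (\<Sum>k<N. 2 * of_real (Re (h (\<zeta> * w ^ k))) * cnj (w ^ k) ^ n)"
      by (simp add: S1_def S2_def sum.distrib[symmetric] ring_distribs[symmetric] complex_add_cnj)
    also have "norm \<dots> \<le> (\<Sum>k<N. 2 * \<bar>Re (h (\<zeta> * w ^ k))\<bar>)"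
      by (rule order_trans[OF norm_sum]) (simp add: norm_mult norm_power)
    also have "\<dots> \<le> 2 * (s * N)" using \<zeta>(2) by (simp flip: sum_distrib_left)
    finally have b3: "norm (S1 + cnj S2) \<le> 2 * (s * N)" .
    have "c n * \<zeta> ^ n * of_nat N = (S1 + cnj S2) - (S1 - c n * \<zeta> ^ n * of_nat N) - cnj S2"
      by simp
    also have "norm \<dots> \<le> norm (S1 + cnj S2) + norm (S1 - c n * \<zeta> ^ n * of_nat N) + norm (cnj S2)"
      by (meson norm_triangle_ineq4 order_trans add_right_mono)
    also have "\<dots> \<le> 2 * (s * N) + real N * t (N - n) + real N * t (N - n)"
      using b1 b2 b3 by (intro add_mono) auto
    finally have "norm (c n) * R ^ n * N \<le> (2 * s + 2 * t (N - n)) * N"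
      by (simp add: norm_mult norm_power \<zeta>(1) algebra_simps)
    then show ?thesis using N by simp
  qed
  have "(\<lambda>N. 2 * s + 2 * t (N - n)) \<longlonglongrightarrow> 2 * s + 2 * 0"
    by (intro tendsto_intros filterlim_compose[OF tlim] filterlim_minus_const_nat_at_top)
  then have "(\<lambda>N. 2 * s + 2 * t (N - n)) \<longlonglongrightarrow> 2 * s" by simp
  moreover have "\<forall>\<^sub>F N in sequentially. norm (c n) * R ^ n \<le> 2 * s + 2 * t (N - n)"
    by (rule eventually_sequentiallyI[of "2 * n + 1"]) (use key in auto)
  ultimately show ?thesis by (rule tendsto_lowerbound) simp
qed

text \<open>
  The hypothesis says that \<open>G\<close> is small where \<open>\<bar>Re h\<bar>\<close> is large. By Jensen's inequality the mean
  of \<open>\<bar>Re h\<bar>\<close> over the circle is at most \<open>s - ln \<bar>G 0\<bar>\<close>, this bounds all Taylor coefficients of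
  \<open>h\<close>, and summing a geometric series bounds \<open>h - h 0\<close>.
\<close>
lemma growth_from_modulus_times_exp_bound:
  fixes G h :: "complex \<Rightarrow> complex"
  assumes G: "G holomorphic_on UNIV" and h: "h holomorphic_on UNIV"
    and G0: "G 0 \<noteq> 0" and r: "norm z \<le> r" "r < R"
    and bd: "\<And>z. norm z = R \<Longrightarrow> norm (G z) \<le> exp (s - \<bar>Re (h z)\<bar>)"
  shows "norm (h z - h 0) \<le> 2 * (s - ln (norm (G 0))) * (r / (R - r))"
proof -
  have R: "R > 0" using r norm_ge_zero[of z] by linarith
  define \<sigma> where "\<sigma> = s - ln (norm (G 0))"
  define c where "c = (\<lambda>m. (deriv ^^ m) h 0 / fact m)"
  have sm: "(\<lambda>m. c m * z ^ m) sums h z" for z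
    using holomorphic_power_series[OF holomorphic_on_subset[OF h], of 0 "norm z + 1" z]
    by (simp add: c_def)
  have mean: "\<exists>\<zeta>. norm \<zeta> = R \<and> (\<Sum>k<N. \<bar>Re (h (\<zeta> * cis (2 * pi / real N) ^ k))\<bar>) \<le> \<sigma> * real N"
    if "N > 0" for N
  proof -
    let ?w = "cis (2 * pi / real N)"
    obtain \<zeta> where \<zeta>: "norm \<zeta> = R" "norm (G 0) ^ N \<le> (\<Prod>k<N. norm (G (\<zeta> * ?w ^ k)))"
      using jensen_roots_of_unity[OF G R, of N ?w] by blast
    have "norm (G 0) ^ N \<le> (\<Prod>k<N. exp (s - \<bar>Re (h (\<zeta> * ?w ^ k))\<bar>))"
      using \<zeta>(2) by (rule order_trans) (auto intro!: prod_mono bd simp: norm_mult norm_power \<zeta>(1))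
    also have "\<dots> = exp (\<Sum>k<N. s - \<bar>Re (h (\<zeta> * ?w ^ k))\<bar>)" by (simp add: exp_sum)
    finally have "ln (norm (G 0) ^ N) \<le> (\<Sum>k<N. s - \<bar>Re (h (\<zeta> * ?w ^ k))\<bar>)"
      using G0 by (subst (asm) ln_le_cancel_iff[symmetric]) auto
    then have "(\<Sum>k<N. \<bar>Re (h (\<zeta> * ?w ^ k))\<bar>) \<le> \<sigma> * real N"
      using G0 by (simp add: \<sigma>_def ln_realpow sum_subtractf algebra_simps)
    then show ?thesis using \<zeta>(1) by blast
  qed
  have cb: "norm (c n) * R ^ n \<le> 2 * \<sigma>" if "n > 0" for n
    using coeff_bound_by_mean_abs_Re[OF sm R that mean] by blast
  have r0: "r \<ge> 0" using r norm_ge_zero[of z] by linarith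
  define q where "q = r / R"
  have q: "0 \<le> q" "q < 1" using r0 r R by (auto simp: q_def)
  have "(\<lambda>m. c m * z ^ m) sums (h z)" "c 0 = h 0" by (rule sm) (simp add: c_def)
  then have d: "(\<lambda>m. c (Suc m) * z ^ Suc m) sums (h z - h 0)"
    by (subst sums_Suc_iff) auto
  have g: "(\<lambda>m. 2 * \<sigma> * q * q ^ m) sums (2 * \<sigma> * q * (1 / (1 - q)))"
    using q by (intro sums_mult geometric_sums) auto
  have t: "norm (c (Suc m) * z ^ Suc m) \<le> 2 * \<sigma> * q * q ^ m" for m
  proof -
    have "norm (c (Suc m) * z ^ Suc m) \<le> norm (c (Suc m)) * r ^ Suc m"
      using r by (simp only: norm_mult norm_power) (intro mult_left_mono power_mono, auto)
    also have "\<dots> = norm (c (Suc m)) * R ^ Suc m * q ^ Suc m"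
      using R by (simp add: q_def power_divide)
    also have "\<dots> \<le> 2 * \<sigma> * q ^ Suc m"
      using cb[of "Suc m"] q by (intro mult_right_mono) auto
    finally show ?thesis by (simp add: mult_ac)
  qed
  have "norm (h z - h 0) \<le> 2 * \<sigma> * q * (1 / (1 - q))"
    using norm_suminf_le[of "\<lambda>m. c (Suc m) * z ^ Suc m", OF t sums_summable[OF g]]
    unfolding sums_unique[OF d, symmetric] sums_unique[OF g, symmetric] .
  also have "\<dots> = 2 * \<sigma> * (r / (R - r))" using R r by (simp add: q_def field_simps)
  finally show ?thesis by (simp add: \<sigma>_def)
qed

section \<open>Functions bounded by their own logarithm\<close>

text \<open>
  Borel's growth lemma. If \<open>l\<close> more than doubled at every step \<open>r \<mapsto> r + 1/(l r)\<^sup>2\<close>, the step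
  lengths would shrink geometrically, the points would stay below \<open>r\<^sub>0 + 2\<close>, and \<open>l\<close> would be
  unbounded there.
\<close>
lemma short_interval_without_doubling:
  fixes l :: "real \<Rightarrow> real"
  assumes mono: "\<And>r s. 0 \<le> r \<Longrightarrow> r \<le> s \<Longrightarrow> l r \<le> l s"
    and one: "\<And>r. 0 \<le> r \<Longrightarrow> 1 \<le> l r" and r0: "0 \<le> r\<^sub>0"
  shows "\<exists>r\<ge>r\<^sub>0. l (r + 1 / (l r)\<^sup>2) \<le> 2 * l r"
proof (rule ccontr)
  assume "\<not> ?thesis"
  then have bad: "l (r + 1 / (l r)\<^sup>2) > 2 * l r" if "r \<ge> r\<^sub>0" for r
    using that by (meson not_less)
  define \<rho> where "\<rho> = rec_nat r\<^sub>0 (\<lambda>_ r. r + 1 / (l r)\<^sup>2)"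
  have \<rho>: "\<rho> 0 = r\<^sub>0" "\<rho> (Suc k) = \<rho> k + 1 / (l (\<rho> k))\<^sup>2" for k
    by (simp_all add: \<rho>_def)
  have ind: "\<rho> k \<ge> r\<^sub>0 \<and> l (\<rho> k) \<ge> 2 ^ k \<and> \<rho> k \<le> r\<^sub>0 + 2 - 2 / 2 ^ k" for k
  proof (induction k)
    case 0
    then show ?case using one[OF r0] by (simp add: \<rho>)
  next
    case (Suc k)
    have "2 ^ k \<le> l (\<rho> k)" using Suc by simp
    also have "\<dots> \<le> (l (\<rho> k))\<^sup>2"
      using one[of "\<rho> k"] Suc r0 by (simp add: power2_eq_square)
    finally have "1 / (l (\<rho> k))\<^sup>2 \<le> 1 / 2 ^ k" by (intro frac_le) auto
    moreover have "2 / 2 ^ k - 2 / 2 ^ Suc k = (1 :: real) / 2 ^ k" by simp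
    moreover have "l (\<rho> (Suc k)) \<ge> 2 ^ Suc k"
      using bad[of "\<rho> k"] Suc by (simp add: \<rho>)
    moreover have "\<rho> (Suc k) \<ge> r\<^sub>0" using Suc by (simp add: \<rho> add_increasing2)
    ultimately show ?case using Suc by (simp add: \<rho>)
  qed
  obtain k where "l (r\<^sub>0 + 2) < 2 ^ k"
    using real_arch_pow[of 2] by auto
  moreover have "\<rho> k \<le> r\<^sub>0 + 2"
  proof -
    have "0 \<le> 2 / (2 :: real) ^ k" by simp
    then show ?thesis using ind[of k] by linarith
  qed
  ultimately show False
    using mono[of "\<rho> k" "r\<^sub>0 + 2"] ind[of k] r0 by force
qed

text \<open>
  The hypothesis is used twice. At a radius supplied by Borel's lemma, applied to
  \<open>l = ln (3 + \<Phi>)\<close>, the step \<open>d = 1/(2 l\<^sup>2)\<close> costs only a power of \<open>l\<close> and shows that \<open>\<Phi> r\<close>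
  is bounded by a power of \<open>r\<close>. With \<open>d = r\<close> the factor \<open>1 + r / d\<close> is constant, and knowing
  the polynomial bound at \<open>3 r\<close> makes \<open>\<Phi> r\<close> logarithmic.
\<close>
lemma sublinear_if_bounded_by_own_logarithm:
  fixes \<Phi> :: "real \<Rightarrow> real"
  assumes mono: "\<And>r s. 0 \<le> r \<Longrightarrow> r \<le> s \<Longrightarrow> \<Phi> r \<le> \<Phi> s"
    and nonneg: "\<And>r. 0 \<le> r \<Longrightarrow> 0 \<le> \<Phi> r"
    and rec: "\<And>r d. 0 < r \<Longrightarrow> 0 < d \<Longrightarrow>
      \<Phi> r \<le> C * (1 + r / d) * (1 + ln (1 + r + d) + ln (1 + \<Phi> (r + 2 * d)) + ln (1 + 1 / d))"
    and C: "C \<ge> 1" and \<epsilon>: "\<epsilon> > 0"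
  shows "\<exists>\<rho>\<ge>r\<^sub>0. \<Phi> \<rho> \<le> \<epsilon> * \<rho>"
proof -
  define l where "l = (\<lambda>r. ln (3 + \<Phi> r))"
  have l_mono: "l r \<le> l s" if "0 \<le> r" "r \<le> s" for r s
    using mono[OF that] nonneg[of r] nonneg[of s] that by (simp add: l_def)
  have l1: "1 \<le> l r" if "0 \<le> r" for r
    using nonneg[OF that] exp_le by (simp add: l_def ln_ge_iff)
  define c where "c = 2 * ln (24 * C) + 8 * ln 8"
  have slow: "l r \<le> c + 4 * ln r"
    if r: "r \<ge> 1" "l (r + 1 / (l r)\<^sup>2) \<le> 2 * l r" for r
  proof -
    define x where "x = l r"
    define d where "d = 1 / (2 * x\<^sup>2)"
    have x1: "x \<ge> 1" using l1 r by (simp add: x_def)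
    have xx: "x \<le> x\<^sup>2" "1 \<le> x\<^sup>2" using self_le_power[OF x1, of 2] one_le_power[OF x1, of 2] by auto
    have d: "d > 0" "d \<le> 1/2" using xx x1 by (auto simp: d_def field_simps)
    have rd: "r + 2 * d = r + 1 / (l r)\<^sup>2" by (simp add: d_def x_def)
    have "\<Phi> r \<le> C * (1 + r / d) * (1 + ln (1 + r + d) + ln (1 + \<Phi> (r + 2 * d)) + ln (1 + 1 / d))"
      using rec[of r d] r d by auto
    also have "\<dots> \<le> C * (3 * (r * x\<^sup>2)) * (7 * (r * x\<^sup>2))"
    proof (intro mult_mono mult_left_mono)
      have rx: "1 \<le> r * x\<^sup>2" "x\<^sup>2 \<le> r * x\<^sup>2" "r \<le> r * x\<^sup>2"
        using r xx mult_mono[of 1 r 1 "x\<^sup>2"] mult_right_mono[of 1 r "x\<^sup>2"]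
          mult_left_mono[of 1 "x\<^sup>2" r] by auto
      have "1 + r / d = 1 + 2 * (r * x\<^sup>2)" using x1 by (simp add: d_def)
      then show "1 + r / d \<le> 3 * (r * x\<^sup>2)" using rx by simp
      have "ln (1 + r + d) \<le> r + d"
        using ln_add_one_self_le_self[of "r + d"] r d by (simp add: add_ac)
      moreover have "ln (1 + \<Phi> (r + 2 * d)) \<le> l (r + 2 * d)"
        using nonneg[of "r + 2 * d"] r d by (simp add: l_def)
      moreover have "l (r + 2 * d) \<le> 2 * x" using r rd by (simp add: x_def)
      moreover have "ln (1 + 1 / d) \<le> 2 * x\<^sup>2"
        using ln_add_one_self_le_self[of "1 / d"] d by (simp add: d_def)
      ultimately show "1 + ln (1 + r + d) + ln (1 + \<Phi> (r + 2 * d)) + ln (1 + 1 / d) \<le> 7 * (r * x\<^sup>2)"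
        using rx xx d by linarith
      show "0 \<le> 1 + ln (1 + r + d) + ln (1 + \<Phi> (r + 2 * d)) + ln (1 + 1 / d)"
        using r d nonneg[of "r + 2 * d"] by (intro add_nonneg_nonneg ln_ge_zero) auto
    qed (use C r d in auto)
    also have "\<dots> = 21 * C * (r\<^sup>2 * x ^ 4)" by (simp add: power2_eq_square power4_eq_xxxx)
    finally have "3 + \<Phi> r \<le> 3 + 21 * C * (r\<^sup>2 * x ^ 4)" by simp
    also have "1 \<le> C * (r\<^sup>2 * x ^ 4)"
      using C r x1 mult_mono[of 1 C 1 "r\<^sup>2 * x ^ 4"] mult_mono[of 1 "r\<^sup>2" 1 "x ^ 4"] by auto
    then have "3 + 21 * C * (r\<^sup>2 * x ^ 4) \<le> (24 * C) * (r\<^sup>2 * x ^ 4)" by simp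
    finally have "3 + \<Phi> r \<le> (24 * C) * (r\<^sup>2 * x ^ 4)" .
    then have "x \<le> ln ((24 * C) * (r\<^sup>2 * x ^ 4))"
      unfolding x_def l_def using nonneg[of r] r by (intro ln_mono) auto
    also have "\<dots> = ln (24 * C) + (2 * ln r + 4 * ln x)"
      using C r x1 by (simp add: ln_mult ln_realpow)
    \<comment> \<open>absorbs \<open>4 ln x\<close> into half of the left-hand side\<close>
    also have "ln x = ln (x / 8) + ln 8" using x1 by (simp add: ln_div)
    also have "ln (x / 8) \<le> x / 8 - 1" using x1 by (intro ln_le_minus_one) auto
    finally show ?thesis by (simp add: c_def x_def)
  qed
  have "\<forall>\<^sub>F r in at_top. 2 * C * (4 + c + 5 * ln (1 + r)) \<le> \<epsilon> * (r / 3)"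
    using \<epsilon> by real_asymp
  then obtain r1 where r1: "\<And>r. r \<ge> r1 \<Longrightarrow> 2 * C * (4 + c + 5 * ln (1 + r)) \<le> \<epsilon> * (r / 3)"
    by (auto simp: eventually_at_top_linorder)
  obtain r where r: "r \<ge> max 1 (max r1 (3 * r\<^sub>0))" "l (r + 1 / (l r)\<^sup>2) \<le> 2 * l r"
    using short_interval_without_doubling[of l "max 1 (max r1 (3 * r\<^sub>0))", OF l_mono l1]
    by (meson max.cobounded1 order_trans zero_le_one)
  have rr: "r \<ge> 1" "r \<ge> r1" "r / 3 \<ge> r\<^sub>0" using r by auto
  have "\<Phi> (r / 3) \<le> 2 * C * (1 + ln (1 + r / 3 + r / 3) + ln (1 + \<Phi> r) + ln (1 + 3 / r))"
    using rec[of "r / 3" "r / 3"] rr by (simp add: mult_ac)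
  also have "\<dots> \<le> 2 * C * (4 + c + 5 * ln (1 + r))"
  proof (rule mult_left_mono)
    have "ln (1 + r / 3 + r / 3) \<le> ln (1 + r)" using rr by (intro ln_mono) auto
    moreover have "ln (1 + \<Phi> r) \<le> l r" using nonneg[of r] rr by (simp add: l_def)
    moreover have "l r \<le> c + 4 * ln r" using slow r rr by simp
    moreover have "ln r \<le> ln (1 + r)" using rr by (intro ln_mono) auto
    moreover have "ln (1 + 3 / r) \<le> 3 / r" using rr by (intro ln_add_one_self_le_self) auto
    moreover have "3 / r \<le> 3" using rr by (simp add: field_simps)
    ultimately show "1 + ln (1 + r / 3 + r / 3) + ln (1 + \<Phi> r) + ln (1 + 3 / r)
        \<le> 4 + c + 5 * ln (1 + r)" by linarith
  qed (use C in auto)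
  also have "\<dots> \<le> \<epsilon> * (r / 3)" using r1 rr by simp
  finally show ?thesis using rr by blast
qed

section \<open>Functions holomorphic on complex lines\<close>

lemma norm_vector_scalar_mult: "norm (c *s (v :: complex ^ 'n)) = norm c * norm v"
  by (simp add: norm_vec_def norm_mult L2_set_right_distrib)

lemma axis_eq_scalar_mult: "axis i w = w *s (axis i 1 :: complex ^ 'n)"
  by (simp add: vec_eq_iff axis_def)

lemma axis_zero [simp]: "axis i (0 :: 'a::zero) = 0"
  by (simp add: vec_eq_iff axis_def)

lemma axis_add: "axis i (a + b :: complex) = axis i a + axis i b"
  by (simp add: vec_eq_iff axis_def)

lemma norm_axis_complex: "norm (axis i w :: complex ^ 'n) = norm w"
  by (subst axis_eq_scalar_mult) (simp add: norm_vector_scalar_mult)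

lemma continuous_on_line [continuous_intros]:
  fixes v :: "complex ^ 'n"
  assumes "continuous_on S f" "continuous_on S g"
  shows "continuous_on S (\<lambda>w. f w + g w *s v)"
  unfolding vector_scalar_mult_def by (intro continuous_intros assms)

text \<open>
  The regularity class in which the argument runs. It contains the entire functions and is
  stable under products, partial derivatives and logarithms; apart from continuity this can be
  checked on single complex lines with one-variable theorems.
\<close>
definition line_holomorphic :: "(complex ^ 'n \<Rightarrow> complex) \<Rightarrow> bool" where
  "line_holomorphic f \<longleftrightarrow>
     continuous_on UNIV f \<and> (\<forall>z v. (\<lambda>w. f (z + w *s v)) holomorphic_on UNIV)"

lemma line_holomorphic_continuous:
  "line_holomorphic f \<Longrightarrow> continuous_on S f"
  unfolding line_holomorphic_def using continuous_on_subset by blast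

lemma line_holomorphic_line:
  "line_holomorphic f \<Longrightarrow> (\<lambda>w. f (z + w *s v)) holomorphic_on S"
  unfolding line_holomorphic_def using holomorphic_on_subset by blast

lemma line_holomorphic_axis:
  "line_holomorphic f \<Longrightarrow> (\<lambda>w. f (z + axis i w)) holomorphic_on S"
  by (subst axis_eq_scalar_mult) (rule line_holomorphic_line)

lemma line_holomorphic_const: "line_holomorphic (\<lambda>_. c)"
  by (simp add: line_holomorphic_def)

lemma line_holomorphic_diff:
  "line_holomorphic f \<Longrightarrow> line_holomorphic g \<Longrightarrow> line_holomorphic (\<lambda>z. f z - g z)"
  by (simp add: line_holomorphic_def continuous_on_diff holomorphic_on_diff)

lemma line_holomorphic_mult:
  "line_holomorphic f \<Longrightarrow> line_holomorphic g \<Longrightarrow> line_holomorphic (\<lambda>z. f z * g z)"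
  by (simp add: line_holomorphic_def continuous_on_mult holomorphic_on_mult)

lemma line_holomorphic_shift:
  fixes f :: "complex ^ 'n \<Rightarrow> complex"
  assumes "line_holomorphic f"
  shows "line_holomorphic (\<lambda>z. f (z + a))"
proof -
  have "continuous_on UNIV (\<lambda>z. f (z + a))"
    by (rule continuous_on_compose2[OF line_holomorphic_continuous[OF assms, of UNIV]])
       (auto intro: continuous_intros)
  moreover have "(\<lambda>w. f (z + w *s v + a)) holomorphic_on UNIV" for z v
    using line_holomorphic_line[OF assms, of "z + a" v UNIV] by (simp add: add_ac)
  ultimately show ?thesis by (simp add: line_holomorphic_def)
qed

lemma entire_line_deriv:
  fixes u :: "complex ^ 'n \<Rightarrow> complex"
  assumes "(u has_derivative D) (at (z + w *s v))" "\<forall>c v. D (c *s v) = c * D v"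
  shows "((\<lambda>w. u (z + w *s v)) has_field_derivative D v) (at w)"
proof -
  have "((\<lambda>w. z + w *s v) has_derivative (\<lambda>h. h *s v)) (at w)"
  proof -
    have "linear (\<lambda>h. h *s v)"
      by (rule linearI) (auto simp: vec_eq_iff algebra_simps)
    then have "((\<lambda>h. h *s v) has_derivative (\<lambda>h. h *s v)) (at w)"
      by (rule bounded_linear_imp_has_derivative[OF linear_conv_bounded_linear[THEN iffD1]])
    from has_derivative_add[OF has_derivative_const[of z] this] show ?thesis by simp
  qed
  from has_derivative_compose[OF this assms(1)]
  have "((\<lambda>w. u (z + w *s v)) has_derivative (\<lambda>h. D (h *s v))) (at w)" .
  moreover have "(\<lambda>h. D (h *s v)) = (*) (D v)"
    using assms(2) by (auto simp: fun_eq_iff mult.commute)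
  ultimately show ?thesis by (simp add: has_field_derivative_def)
qed

lemma entire_imp_line_holomorphic:
  assumes "entire_cn u"
  shows "line_holomorphic u"
  unfolding line_holomorphic_def
proof (intro conjI allI)
  show "continuous_on UNIV u"
    using assms has_derivative_continuous
    by (fastforce simp: entire_cn_def continuous_on_eq_continuous_at)
  show "(\<lambda>w. u (z + w *s v)) holomorphic_on UNIV" for z v
    unfolding holomorphic_on_open[OF open_UNIV]
    using assms entire_line_deriv[of u _ z _ v] by (metis entire_cn_def)
qed

lemma partial_deriv_axis:
  fixes f :: "complex ^ 'n \<Rightarrow> complex"
  assumes "line_holomorphic f"
  shows "((\<lambda>w. f (z + axis i w)) has_field_derivative partial_deriv i f (z + axis i w)) (at w)"
proof -
  have "((\<lambda>w. f (z + axis i w)) has_field_derivative deriv (\<lambda>w. f (z + axis i w)) w) (at w)"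
    by (rule holomorphic_derivI[OF line_holomorphic_axis[OF assms] open_UNIV]) simp
  moreover have "((\<lambda>x. f (z + axis i (x + w))) has_field_derivative deriv (\<lambda>w. f (z + axis i w)) w) (at 0)"
    using calculation DERIV_shift[of "\<lambda>w. f (z + axis i w)" _ 0 w] by simp
  then have "partial_deriv i f (z + axis i w) = deriv (\<lambda>w. f (z + axis i w)) w"
    unfolding partial_deriv_def
    by (intro DERIV_imp_deriv) (simp add: axis_add add_ac)
  ultimately show ?thesis by simp
qed

lemma partial_deriv_eqI:
  "((\<lambda>w. f (z + axis i w)) has_field_derivative d) (at 0) \<Longrightarrow> partial_deriv i f z = d"
  unfolding partial_deriv_def by (rule DERIV_imp_deriv)

lemma partial_deriv_at:
  fixes f :: "complex ^ 'n \<Rightarrow> complex"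
  assumes "line_holomorphic f"
  shows "((\<lambda>w. f (z + axis i w)) has_field_derivative partial_deriv i f z) (at 0)"
  using partial_deriv_axis[OF assms, of z i 0] by simp

lemma partial_deriv_cauchy:
  fixes f :: "complex ^ 'n \<Rightarrow> complex"
  assumes f: "line_holomorphic f" and d: "d > 0"
    and B: "\<And>w. norm w = d \<Longrightarrow> norm (f (z + axis i w)) \<le> B"
  shows "norm (partial_deriv i f z) \<le> B / d"
proof -
  have "norm ((deriv ^^ 1) (\<lambda>w. f (z + axis i w)) 0) \<le> fact 1 * B / d ^ 1"
    using holomorphic_on_imp_continuous_on[OF line_holomorphic_axis[OF f]] d B
    by (intro Cauchy_inequality line_holomorphic_axis[OF f]) auto
  then show ?thesis by (simp add: partial_deriv_def)
qed

text \<open>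
  By Cauchy's estimate the derivative of \<open>x \<mapsto> f (x + a) - f x\<close> is controlled by its values,
  which are small by uniform continuity of \<open>f\<close> on compact sets.
\<close>
lemma partial_deriv_continuous:
  fixes f :: "complex ^ 'n \<Rightarrow> complex"
  assumes f: "line_holomorphic f"
  shows "continuous_on UNIV (partial_deriv i f)"
  unfolding continuous_on_iff
proof (intro ballI allI impI)
  fix z :: "complex ^ 'n" and \<epsilon> :: real assume \<epsilon>: "\<epsilon> > 0"
  have "uniformly_continuous_on (cball z 2) f"
    by (intro compact_uniformly_continuous line_holomorphic_continuous[OF f]) auto
  then obtain \<delta> where \<delta>: "\<delta> > 0"
    "\<And>x y. x \<in> cball z 2 \<Longrightarrow> y \<in> cball z 2 \<Longrightarrow> dist y x < \<delta> \<Longrightarrow> dist (f y) (f x) < \<epsilon> / 2"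
    using \<epsilon> unfolding uniformly_continuous_on_def by (meson half_gt_zero)
  have "dist (partial_deriv i f y) (partial_deriv i f z) < \<epsilon>" if y: "dist y z < min \<delta> 1" for y
  proof -
    define a where "a = y - z"
    have yz: "y = z + a" by (simp add: a_def)
    have na: "norm a < \<delta>" "norm a < 1" using y by (auto simp: a_def dist_norm)
    let ?D = "\<lambda>x. f (x + a) - f x"
    have lh: "line_holomorphic ?D"
      by (intro line_holomorphic_diff line_holomorphic_shift f)
    have "partial_deriv i ?D z = partial_deriv i f y - partial_deriv i f z"
      using partial_deriv_at[OF f, of y i] partial_deriv_at[OF f, of z i]
      by (intro partial_deriv_eqI derivative_intros) (simp add: yz add_ac)
    moreover have "norm (partial_deriv i ?D z) \<le> (\<epsilon> / 2) / 1"
    proof (rule partial_deriv_cauchy[OF lh])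
      fix w :: complex assume w: "norm w = 1"
      have "norm (axis i w + a) \<le> 2"
        using norm_triangle_ineq[of "axis i w" a] w na by (simp add: norm_axis_complex)
      then show "norm (?D (z + axis i w)) \<le> \<epsilon> / 2"
        using \<delta>(2)[of "z + axis i w" "z + axis i w + a"] w na
        by (simp add: dist_norm norm_axis_complex add.assoc norm_minus_commute less_imp_le add.commute[of a])
    qed simp
    ultimately show ?thesis using \<epsilon> by (simp add: dist_norm)
  qed
  then show "\<exists>d>0. \<forall>y\<in>UNIV. dist y z < d \<longrightarrow>
      dist (partial_deriv i f y) (partial_deriv i f z) < \<epsilon>"
    using \<delta>(1) by (intro exI[of _ "min \<delta> 1"]) auto
qed

text \<open>
  The difference quotient with step \<open>1/(n+1)\<close>. A sequence of steps is enough, as these functions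
  serve only as locally uniform holomorphic approximations.
\<close>
definition diff_quot :: "'n \<Rightarrow> nat \<Rightarrow> (complex ^ 'n \<Rightarrow> complex) \<Rightarrow> complex ^ 'n \<Rightarrow> complex" where
  "diff_quot i n f z = of_nat (Suc n) * (f (z + axis i (1 / of_nat (Suc n))) - f z)"

text \<open>
  By the mean value inequality the error is at most the oscillation of the continuous function
  \<open>partial_deriv i f\<close> over a distance \<open>1/(n+1)\<close>.
\<close>
lemma diff_quot_uniform:
  fixes f :: "complex ^ 'n \<Rightarrow> complex"
  assumes f: "line_holomorphic f" and K: "bounded K"
  shows "uniform_limit K (\<lambda>n. diff_quot i n f) (partial_deriv i f) sequentially"
  unfolding uniform_limit_iff
proof (intro allI impI)
  fix \<epsilon> :: real assume \<epsilon>: "\<epsilon> > 0"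
  obtain B where B: "K \<subseteq> ball 0 B" using bounded_subset_ballD[OF K] by blast
  have "uniformly_continuous_on (cball 0 (B + 1)) (partial_deriv i f)"
    using continuous_on_subset[OF partial_deriv_continuous[OF f]]
    by (intro compact_uniformly_continuous) auto
  then obtain \<delta> where \<delta>: "\<delta> > 0"
    "\<And>x y. x \<in> cball 0 (B + 1) \<Longrightarrow> y \<in> cball 0 (B + 1) \<Longrightarrow> dist y x < \<delta> \<Longrightarrow>
       dist (partial_deriv i f y) (partial_deriv i f x) < \<epsilon> / 2"
    using \<epsilon> unfolding uniformly_continuous_on_def by (meson half_gt_zero)
  obtain n0 where n0: "1 / of_nat (Suc n0) < \<delta>"
    using \<delta>(1) nat_approx_posE by blast
  have "dist (diff_quot i n f z) (partial_deriv i f z) < \<epsilon>" if n: "n \<ge> n0" and z: "z \<in> K" for n z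
  proof -
    define t where "t = 1 / real (Suc n)"
    have t: "t > 0" "t \<le> 1" by (auto simp: t_def)
    have "t \<le> 1 / real (Suc n0)" unfolding t_def using n by (intro divide_left_mono) auto
    then have t\<delta>: "t < \<delta>" using n0 by simp
    have tc: "of_real t = 1 / (of_nat (Suc n) :: complex)" by (simp add: t_def)
    have nz: "norm z \<le> B" using z B by force
    have "norm ((f (z + axis i (of_real t)) - of_real t * partial_deriv i f z) -
                (f (z + axis i 0) - 0 * partial_deriv i f z)) \<le> \<epsilon> / 2 * norm (of_real t - (0 :: complex))"
    proof (rule field_differentiable_bound[of "cball 0 t"
          "\<lambda>w. f (z + axis i w) - w * partial_deriv i f z"
          "\<lambda>w. partial_deriv i f (z + axis i w) - partial_deriv i f z"])
      fix w :: complex assume w: "w \<in> cball 0 t"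
      show "((\<lambda>w. f (z + axis i w) - w * partial_deriv i f z) has_field_derivative
             partial_deriv i f (z + axis i w) - partial_deriv i f z) (at w within cball 0 t)"
        by (rule derivative_eq_intros
            has_field_derivative_at_within[OF partial_deriv_axis[OF f]] refl | simp)+
      have "norm (z + axis i w) \<le> B + 1"
        using norm_triangle_ineq[of z "axis i w"] w t nz by (simp add: norm_axis_complex)
      then have "dist (partial_deriv i f (z + axis i w)) (partial_deriv i f z) < \<epsilon> / 2"
        using w t\<delta> nz \<delta>(2)[of z "z + axis i w"] dist_norm[of "z + axis i w" z]
        by (simp add: norm_axis_complex)
      then show "norm (partial_deriv i f (z + axis i w) - partial_deriv i f z) \<le> \<epsilon> / 2"
        by (simp add: dist_norm)
    qed (use t in auto)
    then have *: "norm (f (z + axis i (of_real t)) - f z - of_real t * partial_deriv i f z) \<le> \<epsilon> / 2 * t"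
      using t by (simp add: algebra_simps)
    have "diff_quot i n f z - partial_deriv i f z =
        (f (z + axis i (of_real t)) - f z - of_real t * partial_deriv i f z) / of_real t"
    proof -
      have "of_nat (Suc n) = 1 / (of_real t :: complex)" by (simp only: tc) simp
      then have "diff_quot i n f z = (1 / of_real t) * (f (z + axis i (of_real t)) - f z)"
        by (simp only: diff_quot_def) simp
      then show ?thesis using t by (simp add: field_simps)
    qed
    then have "norm (diff_quot i n f z - partial_deriv i f z) =
        norm (f (z + axis i (of_real t)) - f z - of_real t * partial_deriv i f z) / t"
      using t by (simp add: norm_divide)
    also have "\<dots> \<le> (\<epsilon> / 2 * t) / t" using t by (intro divide_right_mono *) auto
    finally have "norm (diff_quot i n f z - partial_deriv i f z) \<le> \<epsilon> / 2" using t by simp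
    then show ?thesis using \<epsilon> by (simp add: dist_norm)
  qed
  then show "\<forall>\<^sub>F n in sequentially. \<forall>x\<in>K. dist (diff_quot i n f x) (partial_deriv i f x) < \<epsilon>"
    unfolding eventually_sequentially by blast
qed

lemma diff_quot_uniform_line:
  fixes f :: "complex ^ 'n \<Rightarrow> complex"
  assumes f: "line_holomorphic f"
  shows "uniform_limit (cball x d) (\<lambda>n w. diff_quot i n f (z + w *s v))
           (\<lambda>w. partial_deriv i f (z + w *s v)) sequentially"
proof -
  have "bounded ((\<lambda>w. z + w *s v) ` cball x d)"
    by (intro compact_imp_bounded compact_continuous_image continuous_intros) auto
  from diff_quot_uniform[OF f this, of i] show ?thesis
    by (simp add: uniform_limit_iff)
qed

lemma line_holomorphic_diff_quot:
  "line_holomorphic f \<Longrightarrow> line_holomorphic (diff_quot i n f)"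
  using line_holomorphic_mult[OF line_holomorphic_const line_holomorphic_diff[OF line_holomorphic_shift]]
  by (simp add: diff_quot_def[abs_def])

text \<open>
  On each line the derivative is a locally uniform limit of the holomorphic difference quotients.
\<close>
lemma line_holomorphic_partial_deriv:
  fixes f :: "complex ^ 'n \<Rightarrow> complex"
  assumes f: "line_holomorphic f"
  shows "line_holomorphic (partial_deriv i f)"
  unfolding line_holomorphic_def
proof (intro conjI allI partial_deriv_continuous[OF f])
  fix z v :: "complex ^ 'n"
  show "(\<lambda>w. partial_deriv i f (z + w *s v)) holomorphic_on UNIV"
    by (rule holomorphic_uniform_sequence[of UNIV "\<lambda>n w. diff_quot i n f (z + w *s v)"])
       (use diff_quot_uniform_line[OF f]
         line_holomorphic_line[OF line_holomorphic_diff_quot[OF f]] in \<open>auto intro: exI[of _ 1]\<close>)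
qed

text \<open>
  The difference quotients in direction \<open>i\<close> converge locally uniformly on the line in direction
  \<open>j\<close>, so they may be differentiated in direction \<open>j\<close> termwise.
\<close>
lemma partial_deriv_commute:
  fixes f :: "complex ^ 'n \<Rightarrow> complex"
  assumes f: "line_holomorphic f"
  shows "partial_deriv j (partial_deriv i f) z = partial_deriv i (partial_deriv j f) z"
proof -
  have "\<exists>g'. \<forall>x\<in>UNIV. ((\<lambda>w. partial_deriv i f (z + w *s axis j 1)) has_field_derivative g' x) (at x) \<and>
      (\<lambda>n. diff_quot i n (partial_deriv j f) (z + axis j x)) \<longlonglongrightarrow> g' x"
  proof (rule has_complex_derivative_uniform_sequence[OF open_UNIV])
    fix n x
    have "((\<lambda>w. f (z + axis j w + axis i (1 / of_nat (Suc n)))) has_field_derivative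
            partial_deriv j f (z + axis j x + axis i (1 / of_nat (Suc n)))) (at x)"
      using partial_deriv_axis[OF f, of "z + axis i (1 / of_nat (Suc n))" j x]
      by (simp only: ac_simps)
    then show "((\<lambda>w. diff_quot i n f (z + w *s axis j 1)) has_field_derivative
            diff_quot i n (partial_deriv j f) (z + axis j x)) (at x)"
      unfolding diff_quot_def axis_eq_scalar_mult[of j, symmetric]
      by (intro DERIV_cmult DERIV_diff partial_deriv_axis f)
  next
    show "\<exists>d>0. cball x d \<subseteq> UNIV \<and> uniform_limit (cball x d)
        (\<lambda>n w. diff_quot i n f (z + w *s axis j 1)) (\<lambda>w. partial_deriv i f (z + w *s axis j 1)) sequentially"
      for x :: complex
      using diff_quot_uniform_line[OF f] by (auto intro: exI[of _ 1])
  qed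
  then obtain g' where "\<forall>x. ((\<lambda>w. partial_deriv i f (z + axis j w)) has_field_derivative g' x) (at x) \<and>
      (\<lambda>n. diff_quot i n (partial_deriv j f) (z + axis j x)) \<longlonglongrightarrow> g' x"
    unfolding axis_eq_scalar_mult[of j, symmetric] by auto
  from spec[OF this, of 0] have g': "((\<lambda>w. partial_deriv i f (z + axis j w)) has_field_derivative g' 0) (at 0)"
      "(\<lambda>n. diff_quot i n (partial_deriv j f) (z + axis j 0)) \<longlonglongrightarrow> g' 0"
    by auto
  have "(\<lambda>n. diff_quot i n (partial_deriv j f) z) \<longlonglongrightarrow> g' 0" using g'(2) by simp
  moreover have "(\<lambda>n. diff_quot i n (partial_deriv j f) z) \<longlonglongrightarrow> partial_deriv i (partial_deriv j f) z"
    by (rule tendsto_uniform_limitI[OF diff_quot_uniform[OF line_holomorphic_partial_deriv[OF f], of "{z}"]])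
       auto
  ultimately show ?thesis
    using LIMSEQ_unique partial_deriv_eqI[OF g'(1)] by metis
qed

text \<open>
  Such a function takes values in the discrete set \<open>2\<pi>i \<int>\<close>.
\<close>
lemma exp_eq_1_imp_constant:
  fixes f :: "'a::real_normed_vector \<Rightarrow> complex"
  assumes "continuous_on UNIV f" "\<And>x. exp (f x) = 1"
  shows "f x = f y"
proof -
  have "f constant_on UNIV"
  proof (rule continuous_discrete_range_constant[OF connected_UNIV assms(1)])
    fix x
    have "2 * pi \<le> norm (f y - f x)" if "f y \<noteq> f x" for y
    proof -
      have "exp (f y - f x) = 1" using assms(2) by (simp add: exp_diff)
      then obtain n :: int where n: "Re (f y - f x) = 0" "Im (f y - f x) = of_int (2 * n) * pi"
        unfolding exp_eq_1 by blast
      have "n \<noteq> 0" using n that by (auto simp: complex_eq_iff)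
      then have "1 \<le> \<bar>real_of_int n\<bar>" by linarith
      then have "2 * pi \<le> \<bar>Im (f y - f x)\<bar>" unfolding n(2) by (simp add: abs_mult)
      then show ?thesis using abs_Im_le_cmod order_trans by blast
    qed
    then show "\<exists>e>0. \<forall>y. y \<in> UNIV \<and> f y \<noteq> f x \<longrightarrow> e \<le> norm (f y - f x)"
      by (intro exI[of _ "2 * pi"]) auto
  qed
  then show ?thesis by (auto simp: constant_on_def)
qed

lemma continuous_log_holomorphic:
  fixes F p :: "complex \<Rightarrow> complex"
  assumes "F holomorphic_on UNIV" "continuous_on UNIV p" "\<And>w. F w = exp (p w)"
  shows "p holomorphic_on UNIV"
proof -
  obtain q where q: "q holomorphic_on UNIV" "\<And>w. F w = exp (q w)"
    by (rule g_imp_holomorphic_log[OF assms(1,2)]) (simp_all add: assms(3))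
  have const: "p w - q w = p 0 - q 0" for w
  proof (rule exp_eq_1_imp_constant[of "\<lambda>w. p w - q w"])
    show "continuous_on UNIV (\<lambda>w. p w - q w)"
      by (intro continuous_intros assms(2) holomorphic_on_imp_continuous_on q(1))
    show "exp (p w - q w) = 1" for w
      using q(2)[of w] assms(3)[of w] by (simp add: exp_diff)
  qed
  have "q w + (p 0 - q 0) = p w" for w
    unfolding const[of w, symmetric] by simp
  moreover have "(\<lambda>w. q w + (p 0 - q 0)) holomorphic_on UNIV"
    by (intro holomorphic_intros q(1))
  ultimately show ?thesis by simp
qed

text \<open>
  A continuous logarithm exists on the contractible space; on each line it differs by a constant
  from a holomorphic logarithm.
\<close>
lemma line_holomorphic_log:
  fixes f :: "complex ^ 'n \<Rightarrow> complex"
  assumes f: "line_holomorphic f" and nz: "\<And>z. f z \<noteq> 0"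
  obtains p where "line_holomorphic p" "\<And>z. f z = exp (p z)"
proof -
  obtain p where p: "continuous_on UNIV p" "\<And>z. f z = exp (p z)"
    using continuous_logarithm_on_contractible[OF line_holomorphic_continuous[OF f, of UNIV] contractible_UNIV] nz
    by (metis UNIV_I)
  have "(\<lambda>w. p (z + w *s v)) holomorphic_on UNIV" for z v
  proof (rule continuous_log_holomorphic[OF line_holomorphic_line[OF f]])
    show "continuous_on UNIV (\<lambda>w. p (z + w *s v))"
      by (rule continuous_on_compose2[OF p(1)]) (auto intro!: continuous_intros)
  qed (rule p(2))
  then have "line_holomorphic p" using p(1) by (simp add: line_holomorphic_def)
  then show ?thesis using p(2) that by blast
qed

section \<open>Adjacent logarithms\<close>

text \<open>
  The line through a point where \<open>f\<close> does not vanish and a point where \<open>g\<close> does not vanish reduces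
  this to the identity theorem in one variable.
\<close>
lemma line_holomorphic_mult_nonzero:
  fixes f g :: "complex ^ 'n \<Rightarrow> complex"
  assumes f: "line_holomorphic f" "f a \<noteq> 0" and g: "line_holomorphic g" "g b \<noteq> 0"
  shows "\<exists>z. f z * g z \<noteq> 0"
proof (rule ccontr)
  assume "\<not> ?thesis"
  then have zero: "f z * g z = 0" for z by simp
  define F where "F = (\<lambda>w. f (a + w *s (b - a)))"
  define G where "G = (\<lambda>w. g (a + w *s (b - a)))"
  have hol: "F holomorphic_on UNIV" "G holomorphic_on UNIV"
    unfolding F_def G_def by (rule line_holomorphic_line[OF f(1)] line_holomorphic_line[OF g(1)])+
  have F0: "F 0 \<noteq> 0" and G1: "G 1 \<noteq> 0" using f(2) g(2) by (simp_all add: F_def G_def)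
  have "continuous (at 0) F"
    using hol(1) holomorphic_on_imp_continuous_on continuous_on_eq_continuous_at by blast
  then obtain e where e: "e > 0" "\<And>w. dist 0 w < e \<Longrightarrow> F w \<noteq> 0"
    using continuous_at_avoid[of 0 F 0] F0 by auto
  have "G 1 = 0"
  proof (rule analytic_continuation_open[of "ball 0 e" UNIV G "\<lambda>_. 0"])
    show "G w = 0" if "w \<in> ball 0 e" for w
      using e(2)[of w] that zero[of "a + w *s (b - a)"] by (simp add: F_def G_def)
  qed (use e hol in auto)
  then show False using G1 by simp
qed

text \<open>
  Supplies one base point at which all the relevant mixed derivatives are nonzero, so that all
  estimates can be centred there.
\<close>
lemma common_nonzero:
  fixes F :: "'k \<Rightarrow> complex ^ 'n \<Rightarrow> complex"
  assumes "finite S" and "\<And>k. k \<in> S \<Longrightarrow> line_holomorphic (F k)"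
    and "\<And>k. k \<in> S \<Longrightarrow> \<exists>z. F k z \<noteq> 0"
  shows "\<exists>z. \<forall>k\<in>S. F k z \<noteq> 0"
proof -
  have "line_holomorphic (\<lambda>z. \<Prod>k\<in>S. F k z) \<and> (\<exists>z. (\<Prod>k\<in>S. F k z) \<noteq> 0)"
    using assms
  proof (induction S rule: finite_induct)
    case empty
    then show ?case by (simp add: line_holomorphic_const)
  next
    case (insert k S)
    then have IH: "line_holomorphic (\<lambda>z. \<Prod>k\<in>S. F k z)" "\<exists>z. (\<Prod>k\<in>S. F k z) \<noteq> 0"
      by auto
    from insert.prems have k: "line_holomorphic (F k)" "\<exists>z. F k z \<noteq> 0" by auto
    from k(2) IH(2) obtain a b where "F k a \<noteq> 0" "(\<Prod>k\<in>S. F k b) \<noteq> 0" by blast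
    from line_holomorphic_mult_nonzero[OF k(1) this(1) IH(1) this(2)]
      line_holomorphic_mult[OF k(1) IH(1)]
    show ?case using insert.hyps by simp
  qed
  then show ?thesis using assms(1) by (auto simp: prod_zero_iff)
qed

text \<open>
  Liouville's theorem along a sequence of radii: Cauchy's inequality makes every Taylor
  coefficient of positive index vanish.
\<close>
lemma entire_constant_if_sublinear:
  assumes F: "F holomorphic_on UNIV"
    and small: "\<And>\<epsilon>. \<epsilon> > 0 \<Longrightarrow> \<exists>\<rho>\<ge>1. \<forall>w. norm w = \<rho> \<longrightarrow> norm (F w) \<le> \<epsilon> * \<rho>"
  shows "F w = F 0"
proof (rule holomorphic_fun_eq_const_on_connected[OF F open_UNIV connected_UNIV])
  fix n :: nat assume n: "n > 0"
  have "norm ((deriv ^^ n) F 0) \<le> 0 + \<epsilon>" if \<epsilon>: "\<epsilon> > 0" for \<epsilon>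
  proof -
    obtain \<rho> where \<rho>: "\<rho> \<ge> 1" "\<And>w. norm w = \<rho> \<Longrightarrow> norm (F w) \<le> \<epsilon> / fact n * \<rho>"
      using small[of "\<epsilon> / fact n"] \<epsilon> by auto
    have "norm ((deriv ^^ n) F 0) \<le> fact n * (\<epsilon> / fact n * \<rho>) / \<rho> ^ n"
      using \<rho> holomorphic_on_subset[OF F] holomorphic_on_imp_continuous_on[OF F]
      by (intro Cauchy_inequality) (auto intro: continuous_on_subset)
    also have "\<dots> = \<epsilon> * (\<rho> / \<rho> ^ n)" by simp
    also have "\<dots> \<le> \<epsilon> * 1"
      using \<epsilon> \<rho> n self_le_power[of \<rho> n] by (intro mult_left_mono) (auto simp: field_simps)
    finally show ?thesis by simp
  qed
  then have "norm ((deriv ^^ n) F 0) \<le> 0" by (rule field_le_epsilon)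
  then show "(deriv ^^ n) F 0 = 0" by simp
qed auto

text \<open>
  The step in which cancellation is exploited, on the complex lines through \<open>z\<^sub>0\<close>. With
  \<open>h = p - q\<close> the relation gives \<open>A B = B\<^sup>2 exp (- h) = A\<^sup>2 exp h\<close>, and choosing the better of the
  two expressions yields \<open>\<bar>A B\<bar> \<le> (1 + K)\<^sup>2 exp (- \<bar>Re h\<bar>)\<close>. The constant does not depend on the
  line because \<open>A B\<close> is the same at \<open>z\<^sub>0\<close> for all of them.
\<close>
lemma diff_bound_on_ball:
  fixes p q :: "complex ^ 'n \<Rightarrow> complex"
  assumes lh: "line_holomorphic p" "line_holomorphic q" "line_holomorphic A" "line_holomorphic B"
    and rel: "\<And>z. exp (p z) * A z = exp (q z) * B z"
    and nz: "A z\<^sub>0 \<noteq> 0"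
  shows "\<exists>c\<ge>0. \<forall>r d K z. 0 < r \<longrightarrow> 0 < d \<longrightarrow> 0 \<le> K \<longrightarrow>
     (\<forall>x\<in>cball z\<^sub>0 (r + d). norm (A x) \<le> K \<and> norm (B x) \<le> K) \<longrightarrow> z \<in> cball z\<^sub>0 r \<longrightarrow>
     norm (p z - q z) \<le> c * ((1 + r / d) * (1 + ln (1 + K)))"
proof -
  define a where "a = norm (p z\<^sub>0 - q z\<^sub>0)"
  define b where "b = \<bar>ln (norm (A z\<^sub>0 * B z\<^sub>0))\<bar>"
  have nzB: "B z\<^sub>0 \<noteq> 0" using rel[of z\<^sub>0] nz by auto
  have "norm (p z - q z) \<le> (a + (4 + 2 * b)) * ((1 + r / d) * (1 + ln (1 + K)))"
    if rd: "0 < r" "0 < d" and K: "0 \<le> K"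
      and AB: "\<And>x. x \<in> cball z\<^sub>0 (r + d) \<Longrightarrow> norm (A x) \<le> K \<and> norm (B x) \<le> K"
      and z: "z \<in> cball z\<^sub>0 r" for r d K z
  proof -
    define v where "v = z - z\<^sub>0"
    have nv: "norm v \<le> r" using z by (simp add: v_def dist_norm norm_minus_commute)
    define h where "h = (\<lambda>w. p (z\<^sub>0 + w *s v) - q (z\<^sub>0 + w *s v))"
    define G where "G = (\<lambda>w. A (z\<^sub>0 + w *s v) * B (z\<^sub>0 + w *s v))"
    have hol: "h holomorphic_on UNIV" "G holomorphic_on UNIV"
      unfolding h_def G_def by (intro holomorphic_intros line_holomorphic_line lh)+
    have G0: "G 0 = A z\<^sub>0 * B z\<^sub>0" and h0: "h 0 = p z\<^sub>0 - q z\<^sub>0" and h1: "h 1 = p z - q z"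
      by (simp_all add: G_def h_def v_def)
    have bound: "norm (G w) \<le> exp (2 * ln (1 + K) - \<bar>Re (h w)\<bar>)" if w: "norm w = (r + d) / r" for w
    proof -
      let ?x = "z\<^sub>0 + w *s v"
      have "norm (w *s v) \<le> (r + d) / r * r"
        unfolding norm_vector_scalar_mult w using rd nv by (intro mult_left_mono) auto
      then have "?x \<in> cball z\<^sub>0 (r + d)" using rd by (simp add: dist_norm)
      then have k: "norm (A ?x) \<le> 1 + K" "norm (B ?x) \<le> 1 + K" using AB[of ?x] by auto
      have e: "B ?x = exp (h w) * A ?x" "A ?x = exp (- h w) * B ?x"
        using rel[of ?x] by (simp_all add: h_def exp_diff exp_minus field_simps)
      have "norm (G w) \<le> (1 + K) * (1 + K) * exp (- \<bar>Re (h w)\<bar>)"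
      proof (cases "Re (h w) \<ge> 0")
        case True
        have "norm (G w) = norm (B ?x) * norm (B ?x) * exp (- Re (h w))"
          by (simp add: G_def norm_mult e(2) mult_ac)
        also have "\<dots> \<le> (1 + K) * (1 + K) * exp (- Re (h w))"
          using k K by (intro mult_right_mono mult_mono) auto
        finally show ?thesis using True by simp
      next
        case False
        have "norm (G w) = norm (A ?x) * norm (A ?x) * exp (Re (h w))"
          by (simp add: G_def norm_mult e(1) mult_ac)
        also have "\<dots> \<le> (1 + K) * (1 + K) * exp (Re (h w))"
          using k K by (intro mult_right_mono mult_mono) auto
        finally show ?thesis using False by simp
      qed
      also have "\<dots> = exp (2 * ln (1 + K) - \<bar>Re (h w)\<bar>)"
        using K by (simp add: exp_diff exp_minus exp_double power2_eq_square field_simps)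
      finally show ?thesis .
    qed
    \<comment> \<open>the line is parametrized so that \<open>w = 1\<close> is the point \<open>z\<close> and the disc of radius \<open>(r + d) / r\<close> stays in the ball of radius \<open>r + d\<close>\<close>
    have "norm (h 1 - h 0) \<le> 2 * (2 * ln (1 + K) - ln (norm (G 0))) * (1 / ((r + d) / r - 1))"
      by (rule growth_from_modulus_times_exp_bound[OF hol(2,1) _ _ _ bound])
         (use rd nz nzB in \<open>auto simp: G0 field_simps\<close>)
    also have "1 / ((r + d) / r - 1) = r / d" using rd by (simp add: field_simps)
    also have "2 * (2 * ln (1 + K) - ln (norm (G 0))) * (r / d) \<le> (4 * ln (1 + K) + 2 * b) * (r / d)"
      using rd by (intro mult_right_mono) (auto simp: b_def G0)
    also have "\<dots> \<le> ((4 + 2 * b) * (1 + ln (1 + K))) * (1 + r / d)"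
    proof (intro mult_mono)
      have "0 \<le> ln (1 + K)" "0 \<le> b" using K by (auto simp: b_def)
      then show "4 * ln (1 + K) + 2 * b \<le> (4 + 2 * b) * (1 + ln (1 + K))"
        by (simp add: algebra_simps)
      then show "0 \<le> (4 + 2 * b) * (1 + ln (1 + K))"
        using \<open>0 \<le> ln (1 + K)\<close> \<open>0 \<le> b\<close> by simp
    qed (use rd in auto)
    finally have "norm (h 1 - h 0) \<le> (4 + 2 * b) * ((1 + r / d) * (1 + ln (1 + K)))"
      by (simp add: mult_ac)
    moreover have "a * 1 \<le> a * ((1 + r / d) * (1 + ln (1 + K)))"
    proof (rule mult_left_mono)
      show "1 \<le> (1 + r / d) * (1 + ln (1 + K))"
        using mult_mono[of 1 "1 + r / d" 1 "1 + ln (1 + K)"] rd K by simp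
    qed (simp add: a_def)
    moreover have "norm (h 1) \<le> norm (h 1 - h 0) + a"
      using norm_triangle_sub[of "h 1" "h 0"] by (simp add: a_def h0)
    ultimately show ?thesis unfolding h1 by (simp add: distrib_right)
  qed
  moreover have "0 \<le> a + (4 + 2 * b)" by (simp add: a_def b_def)
  ultimately show ?thesis by (intro exI[of _ "a + (4 + 2 * b)"]) blast
qed

section \<open>Connected logarithms differ by constants\<close>

text \<open>
  The logarithm of the Cauchy bound for the gradients, brought into the shape of the recursive
  inequality in \<open>sublinear_if_bounded_by_own_logarithm\<close>.
\<close>
lemma ln_gradient_bound:
  fixes C a r \<delta> \<Phi> :: real
  assumes "C \<ge> 0" "a \<ge> 0" "r > 0" "\<delta> > 0" "\<Phi> \<ge> 0"
  shows "ln (1 + (C * (1 + a + (r + 2 * \<delta>)) ^ m + \<Phi>) / \<delta>) \<le>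
    ln ((1 + C) * (2 * (1 + a)) ^ m) + m * ln (1 + r + \<delta>) + ln (1 + \<Phi>) + ln (1 + 1 / \<delta>)"
proof -
  define Q where "Q = C * (1 + a + (r + 2 * \<delta>)) ^ m"
  have Q0: "Q \<ge> 0" using assms by (simp add: Q_def)
  have base: "1 + a + (r + 2 * \<delta>) \<le> 2 * (1 + a) * (1 + r + \<delta>)"
  proof -
    have "0 \<le> a * r" "0 \<le> a * \<delta>" using assms by auto
    then show ?thesis using assms by (simp add: algebra_simps)
  qed
  have "1 + Q \<le> (1 + C) * (1 + a + (r + 2 * \<delta>)) ^ m"
    using one_le_power[of "1 + a + (r + 2 * \<delta>)" m] assms by (simp add: Q_def distrib_right)
  also have "\<dots> \<le> (1 + C) * (2 * (1 + a) * (1 + r + \<delta>)) ^ m"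
    using base assms by (intro mult_left_mono power_mono) auto
  finally have Q: "1 + Q \<le> (1 + C) * (2 * (1 + a)) ^ m * (1 + r + \<delta>) ^ m"
    by (simp add: power_mult_distrib mult_ac)
  have "1 + (Q + \<Phi>) / \<delta> \<le> (1 + 1 / \<delta>) * ((1 + Q) * (1 + \<Phi>))"
  proof -
    have "1 + Q + \<Phi> \<le> (1 + Q) * (1 + \<Phi>)" using Q0 assms by (simp add: algebra_simps)
    then have "(1 + 1 / \<delta>) * (1 + Q + \<Phi>) \<le> (1 + 1 / \<delta>) * ((1 + Q) * (1 + \<Phi>))"
      using assms by (intro mult_left_mono) auto
    moreover have "1 + (Q + \<Phi>) / \<delta> \<le> (1 + 1 / \<delta>) * (1 + Q + \<Phi>)"
      using Q0 assms by (simp add: field_simps)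
    ultimately show ?thesis by linarith
  qed
  also have "\<dots> \<le> (1 + 1 / \<delta>) * (((1 + C) * (2 * (1 + a)) ^ m * (1 + r + \<delta>) ^ m) * (1 + \<Phi>))"
    using Q assms by (intro mult_left_mono mult_right_mono) auto
  finally have "ln (1 + (Q + \<Phi>) / \<delta>) \<le>
      ln ((1 + 1 / \<delta>) * (((1 + C) * (2 * (1 + a)) ^ m * (1 + r + \<delta>) ^ m) * (1 + \<Phi>)))"
    using Q0 assms by (intro ln_mono) (auto intro: add_pos_nonneg)
  also have "\<dots> = ln (1 + 1 / \<delta>) + (ln ((1 + C) * (2 * (1 + a)) ^ m) + m * ln (1 + r + \<delta>) + ln (1 + \<Phi>))"
  proof -
    have pos: "1 + 1 / \<delta> > 0" "(1 + C) * (2 * (1 + a)) ^ m > 0" "(1 + r + \<delta>) ^ m > 0" "1 + \<Phi> > 0" "1 + r + \<delta> > 0"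
      using assms by (auto intro: add_pos_nonneg)
    then show ?thesis by (simp only: ln_mult_pos mult_pos_pos ln_realpow)
  qed
  finally show ?thesis by (simp add: Q_def)
qed

text \<open>
  The quantity compared at different radii is \<open>\<Phi> r\<close>, the maximum over a ball of the sum of all
  \<open>\<bar>p\<^sub>i - p\<^sub>k\<bar>\<close>. It bounds the \<open>p\<^sub>i\<close> themselves, since their sum grows polynomially, hence by
  Cauchy their gradients on a smaller ball. The previous estimate turns this into a bound for
  the differences over the edges of \<open>E\<close>, connectedness extends it to all pairs, and so \<open>\<Phi>\<close> is
  bounded by its own logarithm.
\<close>
theorem connected_logarithms_differ_by_constants:
  fixes p :: "'n \<Rightarrow> complex ^ 'n \<Rightarrow> complex" and X :: "'n set"
  defines "E \<equiv> (\<lambda>i j. i \<in> X \<and> j \<in> X \<and> (\<exists>z. partial_deriv j (p i) z \<noteq> 0))"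
  assumes lh: "\<And>i. i \<in> X \<Longrightarrow> line_holomorphic (p i)"
    and rel: "\<And>i j z. i \<in> X \<Longrightarrow> j \<in> X \<Longrightarrow>
      exp (p i z) * partial_deriv j (p i) z = exp (p j z) * partial_deriv i (p j) z"
    and conn: "\<And>i j. i \<in> X \<Longrightarrow> j \<in> X \<Longrightarrow> E\<^sup>+\<^sup>+ i j"
    and growth: "\<And>z. norm (\<Sum>i\<in>X. p i z) \<le> C * (1 + norm z) ^ m" and C: "C \<ge> 0"
    and ik: "i\<^sub>0 \<in> X" "k\<^sub>0 \<in> X"
  shows "\<exists>c. \<forall>z. p i\<^sub>0 z - p k\<^sub>0 z = c"
proof -
  define \<Psi> where "\<Psi> = (\<lambda>z. \<Sum>i\<in>X. \<Sum>k\<in>X. norm (p i z - p k z))"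
  have cardX: "real (card X) \<ge> 1"
    using ik(1) by (metis One_nat_def Suc_leI card_gt_0_iff emptyE finite of_nat_1 of_nat_le_iff)
  have \<Psi>_cont: "continuous_on S \<Psi>" for S
    unfolding \<Psi>_def by (intro continuous_intros line_holomorphic_continuous lh)
  have \<Psi>0: "\<Psi> z \<ge> 0" for z unfolding \<Psi>_def by (intro sum_nonneg) auto
  have diff_le: "norm (p i z - p k z) \<le> \<Psi> z" if "i \<in> X" "k \<in> X" for i k z
  proof -
    have "norm (p i z - p k z) \<le> (\<Sum>k\<in>X. norm (p i z - p k z))"
      by (rule member_le_sum[OF that(2)]) auto
    also have "\<dots> \<le> \<Psi> z"
      unfolding \<Psi>_def
      by (rule member_le_sum[OF that(1), of "\<lambda>i. \<Sum>k\<in>X. norm (p i z - p k z)"]) (auto intro: sum_nonneg)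
    finally show ?thesis .
  qed
  \<comment> \<open>\<open>card X\<close> times \<open>p i\<close> is the sum of all \<open>p k\<close> plus the sum of all differences\<close>
  have p_le: "norm (p i z) \<le> C * (1 + norm z) ^ m + \<Psi> z" if i: "i \<in> X" for i z
  proof -
    have "of_nat (card X) * p i z = (\<Sum>k\<in>X. p k z) + (\<Sum>k\<in>X. p i z - p k z)"
      by (simp add: sum_subtractf)
    then have "card X * norm (p i z) = norm ((\<Sum>k\<in>X. p k z) + (\<Sum>k\<in>X. p i z - p k z))"
      by (metis norm_mult norm_of_nat)
    also have "\<dots> \<le> C * (1 + norm z) ^ m + (\<Sum>k\<in>X. norm (p i z - p k z))"
      by (intro order_trans[OF norm_triangle_ineq] add_mono growth norm_sum)
    also have "(\<Sum>k\<in>X. norm (p i z - p k z)) \<le> \<Psi> z"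
      unfolding \<Psi>_def
      by (rule member_le_sum[OF i, of "\<lambda>i. \<Sum>k\<in>X. norm (p i z - p k z)"]) (auto intro: sum_nonneg)
    finally have "card X * norm (p i z) \<le> C * (1 + norm z) ^ m + \<Psi> z" by simp
    moreover have "1 * norm (p i z) \<le> card X * norm (p i z)"
      using cardX by (intro mult_right_mono) auto
    ultimately show ?thesis by linarith
  qed
  obtain z\<^sub>0 where z0: "\<And>i j. E i j \<Longrightarrow> partial_deriv j (p i) z\<^sub>0 \<noteq> 0"
  proof -
    have "\<exists>z. \<forall>k\<in>{(i, j). E i j}. partial_deriv (snd k) (p (fst k)) z \<noteq> 0"
    proof (rule common_nonzero)
      show "line_holomorphic (partial_deriv (snd k) (p (fst k)))" if "k \<in> {(i, j). E i j}" for k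
        using that by (intro line_holomorphic_partial_deriv lh) (auto simp: E_def)
    qed (auto simp: E_def)
    then show ?thesis using that by auto
  qed
  define \<Phi> where "\<Phi> = (\<lambda>r. SUP z\<in>cball z\<^sub>0 r. \<Psi> z)"
  have bdd: "bdd_above (\<Psi> ` cball z\<^sub>0 r)" for r
    by (intro bounded_imp_bdd_above compact_imp_bounded compact_continuous_image \<Psi>_cont compact_cball)
  have \<Psi>_le: "\<Psi> z \<le> \<Phi> r" if "z \<in> cball z\<^sub>0 r" for z r
    unfolding \<Phi>_def by (rule cSUP_upper[OF that bdd])
  have \<Phi>_le: "\<Phi> r \<le> B" if "0 \<le> r" "\<And>z. z \<in> cball z\<^sub>0 r \<Longrightarrow> \<Psi> z \<le> B" for r B
    unfolding \<Phi>_def by (rule cSUP_least) (use that in auto)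
  have \<Phi>_mono: "\<Phi> r \<le> \<Phi> s" if "0 \<le> r" "r \<le> s" for r s
    by (rule \<Phi>_le[OF that(1)]) (use that in \<open>auto intro!: \<Psi>_le\<close>)
  have \<Phi>_nonneg: "0 \<le> \<Phi> r" if "0 \<le> r" for r
    using \<Psi>_le[of z\<^sub>0 r] \<Psi>0[of z\<^sub>0] that by auto
  \<comment> \<open>the Cauchy bound, from discs of radius \<open>d\<close>, for the partial derivatives on the ball of radius \<open>r + d\<close>\<close>
  define K where "K = (\<lambda>r d. (C * (1 + norm z\<^sub>0 + (r + 2 * d)) ^ m + \<Phi> (r + 2 * d)) / d)"
  have K0: "0 \<le> K r d" if "0 < r" "0 < d" for r d
    using that C \<Phi>_nonneg[of "r + 2 * d"] by (simp add: K_def)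
  have grad: "norm (partial_deriv j (p i) x) \<le> K r d"
    if i: "i \<in> X" and rd: "0 < r" "0 < d" and x: "x \<in> cball z\<^sub>0 (r + d)" for i j x r d
    unfolding K_def
  proof (rule partial_deriv_cauchy[OF lh[OF i] rd(2)])
    fix w :: complex assume w: "norm w = d"
    have nx: "norm (x - z\<^sub>0) \<le> r + d" using x by (simp add: dist_norm norm_minus_commute)
    have "norm (x + axis j w - z\<^sub>0) \<le> r + 2 * d"
      using norm_triangle_ineq[of "x - z\<^sub>0" "axis j w"] nx w by (simp add: norm_axis_complex algebra_simps)
    then have "x + axis j w \<in> cball z\<^sub>0 (r + 2 * d)" by (simp add: dist_norm norm_minus_commute)
    then have "\<Psi> (x + axis j w) \<le> \<Phi> (r + 2 * d)" by (rule \<Psi>_le)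
    moreover have "norm (x + axis j w) \<le> norm z\<^sub>0 + (r + 2 * d)"
      using norm_triangle_sub[of "x + axis j w" z\<^sub>0] \<open>norm (x + axis j w - z\<^sub>0) \<le> r + 2 * d\<close> by simp
    then have "C * (1 + norm (x + axis j w)) ^ m \<le> C * (1 + norm z\<^sub>0 + (r + 2 * d)) ^ m"
      using C by (intro mult_left_mono power_mono) auto
    ultimately show "norm (p i (x + axis j w)) \<le> C * (1 + norm z\<^sub>0 + (r + 2 * d)) ^ m + \<Phi> (r + 2 * d)"
      using p_le[OF i, of "x + axis j w"] by linarith
  qed
  define W where "W = (\<lambda>r d. (1 + r / d) * (1 + ln (1 + K r d)))"
  define bnd where "bnd = (\<lambda>i j c. 0 \<le> c \<and>
    (\<forall>r d z. 0 < r \<longrightarrow> 0 < d \<longrightarrow> z \<in> cball z\<^sub>0 r \<longrightarrow> norm (p i z - p j z) \<le> c * W r d))"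
  have edge: "\<exists>c. bnd i j c" if E: "E i j" for i j
  proof -
    have ij: "i \<in> X" "j \<in> X" using E by (auto simp: E_def)
    obtain c where c: "c \<ge> 0" "\<And>r d K z. 0 < r \<Longrightarrow> 0 < d \<Longrightarrow> 0 \<le> K \<Longrightarrow>
       (\<forall>x\<in>cball z\<^sub>0 (r + d). norm (partial_deriv j (p i) x) \<le> K \<and> norm (partial_deriv i (p j) x) \<le> K) \<Longrightarrow>
       z \<in> cball z\<^sub>0 r \<Longrightarrow> norm (p i z - p j z) \<le> c * ((1 + r / d) * (1 + ln (1 + K)))"
      using diff_bound_on_ball[OF lh[OF ij(1)] lh[OF ij(2)] line_holomorphic_partial_deriv[OF lh[OF ij(1)]]
          line_holomorphic_partial_deriv[OF lh[OF ij(2)]] rel[OF ij] z0[OF E]] by metis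
    have "bnd i j c"
      unfolding bnd_def W_def
    proof (intro conjI allI impI c(1))
      fix r d :: real and z assume "0 < r" "0 < d" "z \<in> cball z\<^sub>0 r"
      then show "norm (p i z - p j z) \<le> c * ((1 + r / d) * (1 + ln (1 + K r d)))"
        using grad[OF ij(1)] grad[OF ij(2)] by (intro c(2) K0) auto
    qed
    then show ?thesis by blast
  qed
  have chain: "\<exists>c. bnd i j c" if "E\<^sup>+\<^sup>+ i j" for i j
    using that
  proof (induction rule: tranclp_induct)
    case (base j)
    then show ?case by (rule edge)
  next
    case (step j k)
    obtain c c' where c: "bnd i j c" "bnd j k c'" using step.IH edge[OF step.hyps(2)] by blast
    have "bnd i k (c + c')"
      unfolding bnd_def
    proof (intro conjI allI impI)
      show "0 \<le> c + c'" using c by (simp add: bnd_def)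
      fix r d :: real and z assume "0 < r" "0 < d" "z \<in> cball z\<^sub>0 r"
      then have "norm (p i z - p j z) \<le> c * W r d" "norm (p j z - p k z) \<le> c' * W r d"
        using c by (auto simp: bnd_def)
      then show "norm (p i z - p k z) \<le> (c + c') * W r d"
        using norm_triangle_ineq[of "p i z - p j z" "p j z - p k z"] by (simp add: distrib_right)
    qed
    then show ?case by blast
  qed
  have "\<exists>c. \<forall>i\<in>X. \<forall>j\<in>X. bnd i j (c i j)"
    using chain[OF conn] by (intro exI[of _ "\<lambda>i j. SOME c. bnd i j c"]) (auto intro: someI_ex)
  then obtain c where c: "\<And>i j. i \<in> X \<Longrightarrow> j \<in> X \<Longrightarrow> bnd i j (c i j)" by blast
  define S where "S = (\<Sum>i\<in>X. \<Sum>j\<in>X. c i j)"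
  have S0: "S \<ge> 0" unfolding S_def using c by (intro sum_nonneg) (auto simp: bnd_def)
  have rec1: "\<Phi> r \<le> S * W r d" if rd: "0 < r" "0 < d" for r d
  proof (rule \<Phi>_le)
    fix z assume z: "z \<in> cball z\<^sub>0 r"
    have "\<Psi> z \<le> (\<Sum>i\<in>X. \<Sum>j\<in>X. c i j * W r d)"
      unfolding \<Psi>_def using c rd z by (intro sum_mono) (auto simp: bnd_def)
    then show "\<Psi> z \<le> S * W r d" by (simp add: S_def sum_distrib_right)
  qed (use rd in auto)
  define c0 where "c0 = \<bar>ln ((1 + C) * (2 * (1 + norm z\<^sub>0)) ^ m)\<bar>"
  define C3 where "C3 = max 1 (S * (2 + c0 + m))"
  have c00: "c0 \<ge> 0" by (simp add: c0_def)
  have rec2: "\<Phi> r \<le> C3 * (1 + r / d) * (1 + ln (1 + r + d) + ln (1 + \<Phi> (r + 2 * d)) + ln (1 + 1 / d))"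
    if rd: "0 < r" "0 < d" for r d
  proof -
    define x y t where "x = ln (1 + r + d)" and "y = ln (1 + \<Phi> (r + 2 * d))" and "t = ln (1 + 1 / d)"
    have pos: "0 \<le> x" "0 \<le> y" "0 \<le> t"
      unfolding x_def y_def t_def using rd \<Phi>_nonneg[of "r + 2 * d"] by auto
    have "ln (1 + K r d) \<le> c0 + m * x + y + t"
      unfolding K_def c0_def x_def y_def t_def
      using ln_gradient_bound[OF C norm_ge_zero rd \<Phi>_nonneg[of "r + 2 * d"], of z\<^sub>0 m] rd
        abs_ge_self[of "ln ((1 + C) * (2 * (1 + norm z\<^sub>0)) ^ m)"] by auto
    also have "1 + (c0 + m * x + y + t) \<le> (2 + c0 + m) * (1 + x + y + t)"
    proof -
      have "0 \<le> c0 * x" "0 \<le> c0 * y" "0 \<le> c0 * t" "0 \<le> m * y" "0 \<le> m * t" using pos c00 by auto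
      then show ?thesis using pos by (simp add: algebra_simps)
    qed
    finally have L: "1 + ln (1 + K r d) \<le> (2 + c0 + m) * (1 + x + y + t)" by simp
    have "\<Phi> r \<le> S * ((1 + r / d) * (1 + ln (1 + K r d)))" using rec1[OF rd] by (simp add: W_def)
    also have "\<dots> \<le> S * ((1 + r / d) * ((2 + c0 + m) * (1 + x + y + t)))"
      using L rd S0 by (intro mult_left_mono) auto
    also have "\<dots> = (S * (2 + c0 + m)) * ((1 + r / d) * (1 + x + y + t))" by (simp add: mult_ac)
    also have "\<dots> \<le> C3 * ((1 + r / d) * (1 + x + y + t))"
      using rd pos by (intro mult_right_mono) (auto simp: C3_def)
    finally show ?thesis by (simp add: x_def y_def t_def mult_ac)
  qed
  have sub: "\<exists>\<rho>\<ge>r\<^sub>0. \<Phi> \<rho> \<le> \<epsilon> * \<rho>" if "\<epsilon> > 0" for \<epsilon> r\<^sub>0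
    by (rule sublinear_if_bounded_by_own_logarithm[OF \<Phi>_mono \<Phi>_nonneg rec2 _ that])
       (auto simp: C3_def)
  have "p i\<^sub>0 z - p k\<^sub>0 z = p i\<^sub>0 z\<^sub>0 - p k\<^sub>0 z\<^sub>0" for z
  proof (cases "z = z\<^sub>0")
    case False
    define v where "v = z - z\<^sub>0"
    have v: "norm v > 0" using False by (simp add: v_def)
    define F where "F = (\<lambda>w. p i\<^sub>0 (z\<^sub>0 + w *s v) - p k\<^sub>0 (z\<^sub>0 + w *s v))"
    have "F 1 = F 0"
    proof (rule entire_constant_if_sublinear)
      show "F holomorphic_on UNIV"
        unfolding F_def by (intro holomorphic_intros line_holomorphic_line lh ik)
    next
      fix \<epsilon> :: real assume \<epsilon>: "\<epsilon> > 0"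
      obtain \<rho> where \<rho>: "\<rho> \<ge> norm v" "\<Phi> \<rho> \<le> \<epsilon> / norm v * \<rho>"
        using sub[of "\<epsilon> / norm v" "norm v"] \<epsilon> v by auto
      have "norm (F w) \<le> \<epsilon> * (\<rho> / norm v)" if w: "norm w = \<rho> / norm v" for w
      proof -
        have "z\<^sub>0 + w *s v \<in> cball z\<^sub>0 \<rho>"
          using v w by (simp add: dist_norm norm_vector_scalar_mult)
        then have "norm (F w) \<le> \<Phi> \<rho>"
          using diff_le[OF ik, of "z\<^sub>0 + w *s v"] \<Psi>_le[of "z\<^sub>0 + w *s v" \<rho>] by (simp add: F_def)
        then show ?thesis using \<rho>(2) by simp
      qed
      then show "\<exists>\<rho>\<ge>1. \<forall>w. norm w = \<rho> \<longrightarrow> norm (F w) \<le> \<epsilon> * \<rho>"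
        using \<rho>(1) v by (intro exI[of _ "\<rho> / norm v"]) auto
    qed
    then show ?thesis by (simp add: F_def v_def)
  qed simp
  then show ?thesis by blast
qed

section \<open>Polynomials and separated coordinates\<close>

lemma norm_polynomial_le:
  fixes g :: "complex ^ 'n \<Rightarrow> complex"
  assumes "polynomial_cn g"
  shows "\<exists>C m. C \<ge> 0 \<and> (\<forall>z. norm (g z) \<le> C * (1 + norm z) ^ m)"
proof -
  obtain M :: "('n \<Rightarrow> nat) set" and c where M: "finite M"
      "\<And>z. g z = (\<Sum>m\<in>M. c m * (\<Prod>i\<in>UNIV. (z $ i) ^ m i))"
    using assms unfolding polynomial_cn_def by blast
  define d where "d = (\<Sum>m\<in>M. \<Sum>i\<in>UNIV. m i)"
  have "norm (g z) \<le> (\<Sum>m\<in>M. norm (c m)) * (1 + norm z) ^ d" for z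
  proof -
    have "norm (g z) \<le> (\<Sum>m\<in>M. norm (c m * (\<Prod>i\<in>UNIV. (z $ i) ^ m i)))"
      unfolding M(2) by (rule norm_sum)
    also have "\<dots> \<le> (\<Sum>m\<in>M. norm (c m) * (1 + norm z) ^ d)"
    proof (rule sum_mono)
      fix m assume m: "m \<in> M"
      have "norm (\<Prod>i\<in>UNIV. (z $ i) ^ m i) = (\<Prod>i\<in>UNIV. norm (z $ i) ^ m i)"
        by (simp add: prod_norm[symmetric] norm_power)
      also have "\<dots> \<le> (\<Prod>i\<in>UNIV. (1 + norm z) ^ m i)"
      proof (rule prod_mono)
        fix i
        have "norm (z $ i) \<le> 1 + norm z"
          using Finite_Cartesian_Product.norm_nth_le[of z i] by simp
        then show "0 \<le> norm (z $ i) ^ m i \<and> norm (z $ i) ^ m i \<le> (1 + norm z) ^ m i"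
          by (auto intro: power_mono)
      qed
      also have "\<dots> = (1 + norm z) ^ (\<Sum>i\<in>UNIV. m i)" by (simp add: power_sum)
      also have "\<dots> \<le> (1 + norm z) ^ d"
        unfolding d_def
        using member_le_sum[OF m, of "\<lambda>m. \<Sum>i\<in>UNIV. m i"] M(1) by (intro power_increasing) auto
      finally show "norm (c m * (\<Prod>i\<in>UNIV. (z $ i) ^ m i)) \<le> norm (c m) * (1 + norm z) ^ d"
        by (simp add: norm_mult mult_left_mono)
    qed
    finally show ?thesis by (simp add: sum_distrib_right)
  qed
  then show ?thesis by (intro exI[of _ "\<Sum>m\<in>M. norm (c m)"] exI[of _ d]) (auto intro: sum_nonneg)
qed

lemma continuous_polynomial:
  fixes g :: "complex ^ 'n \<Rightarrow> complex"
  assumes "polynomial_cn g"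
  shows "continuous_on S g"
proof -
  obtain M :: "('n \<Rightarrow> nat) set" and c where
      "\<And>z. g z = (\<Sum>m\<in>M. c m * (\<Prod>i\<in>UNIV. (z $ i) ^ m i))"
    using assms unfolding polynomial_cn_def by blast
  then have "g = (\<lambda>z. \<Sum>m\<in>M. c m * (\<Prod>i\<in>UNIV. (z $ i) ^ m i))" by blast
  then show ?thesis by (auto intro!: continuous_intros)
qed

text \<open>
  Additivity of the Frechet derivative expresses the derivative in an arbitrary direction through
  the partial derivatives.
\<close>
lemma entire_directional_derivative:
  fixes u :: "complex ^ 'n \<Rightarrow> complex"
  assumes "entire_cn u"
  shows "((\<lambda>w. u (z + w *s v)) has_field_derivative
     (\<Sum>i\<in>UNIV. v $ i * partial_deriv i u (z + w *s v))) (at w)"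
proof -
  obtain D where D: "(u has_derivative D) (at (z + w *s v))" "\<forall>c v. D (c *s v) = c * D v"
    using assms unfolding entire_cn_def by blast
  have lin: "linear D" using has_derivative_linear[OF D(1)] .
  have "partial_deriv i u (z + w *s v) = D (axis i 1)" for i
  proof (rule partial_deriv_eqI)
    show "((\<lambda>x. u (z + w *s v + axis i x)) has_field_derivative D (axis i 1)) (at 0)"
      using entire_line_deriv[of u D "z + w *s v" 0 "axis i 1"] D
      by (simp flip: axis_eq_scalar_mult)
  qed
  moreover have "v = (\<Sum>i\<in>UNIV. v $ i *s axis i 1)"
    by (simp add: basis_expansion)
  then have "D v = (\<Sum>i\<in>UNIV. D (v $ i *s axis i 1))"
    using linear_sum[OF lin] by metis
  ultimately have "D v = (\<Sum>i\<in>UNIV. v $ i * partial_deriv i u (z + w *s v))"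
    using D(2) by simp
  then show ?thesis using entire_line_deriv[OF D] by simp
qed

lemma constant_along_axis:
  fixes f :: "complex ^ 'n \<Rightarrow> complex"
  assumes f: "line_holomorphic f" and "\<And>z. partial_deriv j f z = 0"
  shows "f (z + axis j w) = f z"
proof -
  have "((\<lambda>w. f (z + axis j w)) has_field_derivative 0) (at x within UNIV)" for x
    using partial_deriv_axis[OF f, of z j x] assms(2) by simp
  then have "(\<lambda>w. f (z + axis j w)) constant_on UNIV"
    using has_field_derivative_zero_constant[OF convex_UNIV] unfolding constant_on_def by blast
  then have "f (z + axis j w) = f (z + axis j 0)" unfolding constant_on_def by (metis UNIV_I)
  then show ?thesis by simp
qed

text \<open>
  Changes the coordinates in \<open>S\<close> one at a time.
\<close>
lemma independent_of_coordinates: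
  fixes f :: "complex ^ 'n \<Rightarrow> complex" and x y :: "complex ^ 'n"
  assumes f: "line_holomorphic f" and zero: "\<And>j z. j \<in> S \<Longrightarrow> partial_deriv j f z = 0"
    and eq: "\<And>k. k \<notin> S \<Longrightarrow> x $ k = y $ k"
  shows "f x = f y"
proof -
  have "finite S" by simp
  then show ?thesis using zero eq
  proof (induction S arbitrary: x rule: finite_induct)
    case empty
    then have "x = y" by (simp add: vec_eq_iff)
    then show ?case by simp
  next
    case (insert j S)
    define x' where "x' = x + axis j (y $ j - x $ j)"
    have "f x' = f y"
    proof (rule insert.IH)
      show "x' $ k = y $ k" if "k \<notin> S" for k
        using insert.prems(2)[of k] that by (auto simp: x'_def axis_def)
    qed (use insert.prems in auto)
    moreover have "f x' = f x"
      unfolding x'_def by (rule constant_along_axis[OF f]) (use insert.prems in auto)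
    ultimately show ?case by simp
  qed
qed

definition coord_restrict :: "'n set \<Rightarrow> complex ^ 'n \<Rightarrow> complex ^ 'n" where
  "coord_restrict S z = (\<chi> k. if k \<in> S then z $ k else 0)"

lemma coord_restrict_nth [simp]: "coord_restrict S z $ k = (if k \<in> S then z $ k else 0)"
  by (simp add: coord_restrict_def)

lemma norm_coord_restrict: "norm (coord_restrict S z) \<le> norm z"
  unfolding norm_vec_def by (rule L2_set_mono) auto

text \<open>
  If \<open>j\<close> is isolated, the derivative in direction \<open>j\<close> depends on the \<open>j\<close>-th coordinate only, so
  changing that coordinate adds the same increment at every point. Doing this for each \<open>j\<close> in
  turn splits off the isolated variables.
\<close>
lemma split_off_separated_coordinates:
  fixes u :: "complex ^ 'n \<Rightarrow> complex" and y z :: "complex ^ 'n"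
  assumes u: "line_holomorphic u"
    and sep: "\<And>j k z. j \<in> J \<Longrightarrow> k \<noteq> j \<Longrightarrow> partial_deriv k (partial_deriv j u) z = 0"
    and y: "\<And>j. j \<in> J \<Longrightarrow> y $ j = 0"
  shows "u (coord_restrict J z + y) = u y + (\<Sum>j\<in>J. u (axis j (z $ j)) - u 0)"
proof -
  have one: "u (x + axis j w) - u (axis j w) = u x - u 0" if j: "j \<in> J" and x: "x $ j = 0" for x :: "complex ^ 'n" and j w
  proof -
    have eq: "partial_deriv j u (x + axis j w) = partial_deriv j u (0 + axis j w)" for w
      by (rule independent_of_coordinates[OF line_holomorphic_partial_deriv[OF u], of "- {j}"])
         (use sep[OF j] x in auto)
    have "((\<lambda>w. u (x + axis j w) - u (0 + axis j w)) has_field_derivative 0) (at w within UNIV)" for w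
      using DERIV_diff[OF partial_deriv_axis[OF u, of x j w] partial_deriv_axis[OF u, of 0 j w]] eq[of w]
      by simp
    then have "(\<lambda>w. u (x + axis j w) - u (0 + axis j w)) constant_on UNIV"
      using has_field_derivative_zero_constant[OF convex_UNIV] unfolding constant_on_def by blast
    then have "u (x + axis j w) - u (0 + axis j w) = u (x + axis j 0) - u (0 + axis j 0)"
      unfolding constant_on_def by (metis UNIV_I)
    then show ?thesis by simp
  qed
  have "finite J" by simp
  then show ?thesis using one y
  proof (induction J rule: finite_induct)
    case empty
    have "coord_restrict {} z = 0" by (simp add: vec_eq_iff)
    then show ?case by simp
  next
    case (insert j J)
    have IH: "u (coord_restrict J z + y) = u y + (\<Sum>j\<in>J. u (axis j (z $ j)) - u 0)"
      by (rule insert.IH) (use insert.prems in auto)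
    have "coord_restrict (insert j J) z + y = (coord_restrict J z + y) + axis j (z $ j)"
      using insert.hyps by (auto simp: vec_eq_iff axis_def)
    moreover have "(coord_restrict J z + y) $ j = 0" using insert by simp
    ultimately show ?case
      using insert.prems(1)[of j "coord_restrict J z + y" "z $ j"] insert.hyps IH
      by (simp add: algebra_simps)
  qed
qed

section \<open>The normal form for a single block\<close>

text \<open>
  Since the logarithms over the linked set \<open>X\<close> differ by constants, \<open>u\<^sub>i = A\<^sub>i V\<close> for \<open>i \<in> X\<close>,
  where the \<open>A\<^sub>i\<close> can be scaled to have product \<open>1\<close>. Then \<open>u\<close> is invariant under translations
  inside the linked coordinates that preserve \<open>L z = \<Sum> A\<^sub>i z\<^sub>i\<close>, so every point may be moved to
  its isolated coordinates plus a multiple of one vector \<open>b\<close> with \<open>L b = 1\<close>; restricting \<open>u\<close> to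
  the line through \<open>b\<close> gives \<open>f\<close>. Multiplying the partial derivatives recovers \<open>g\<close> up to an
  integer multiple of \<open>2\<pi>i\<close>.
\<close>
theorem one_block_structure:
  fixes g u :: "complex ^ 'n \<Rightarrow> complex"
  defines "X \<equiv> linked_indices u" and "J \<equiv> isolated_indices u"
  assumes g: "polynomial_cn g" and entire: "entire_cn u"
    and eqn: "\<And>z. (\<Prod>i\<in>UNIV. partial_deriv i u z) = exp (g z)"
    and one: "num_blocks u = 1"
  obtains A :: "'n \<Rightarrow> complex" and \<phi> f :: "complex \<Rightarrow> complex"
    and h H :: "'n \<Rightarrow> complex \<Rightarrow> complex" and k :: int
  where "(\<Prod>i\<in>X. A i) = 1"
    "\<phi> holomorphic_on UNIV" "f holomorphic_on UNIV" "\<And>w. (f has_field_derivative exp (\<phi> w)) (at w)"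
    "\<And>j. j \<in> J \<Longrightarrow> h j holomorphic_on UNIV" "\<And>j. j \<in> J \<Longrightarrow> H j holomorphic_on UNIV"
    "\<And>j w. j \<in> J \<Longrightarrow> deriv (H j) w = exp (h j w)"
    "\<And>z. g z = (\<Sum>j\<in>J. h j (z $ j)) + of_nat (card X) * \<phi> (\<Sum>i\<in>X. A i * z $ i)
            + 2 * of_int k * of_real pi * \<i>"
    "\<And>z. u z = (\<Sum>j\<in>J. H j (z $ j)) + f (\<Sum>i\<in>X. A i * z $ i)"
proof -
  have u: "line_holomorphic u" by (rule entire_imp_line_holomorphic[OF entire])
  have ui: "line_holomorphic (partial_deriv i u)" for i by (rule line_holomorphic_partial_deriv[OF u])
  have comm: "partial_deriv j (partial_deriv i u) z = partial_deriv i (partial_deriv j u) z" for i j z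
    by (rule partial_deriv_commute[OF u])
  have XJ: "X = UNIV - J" by (simp add: X_def J_def linked_indices_def)
  have nz: "partial_deriv i u z \<noteq> 0" for i z
  proof
    assume "partial_deriv i u z = 0"
    then have "(\<Prod>i\<in>UNIV. partial_deriv i u z) = 0" by (auto simp: prod_zero_iff)
    then show False using eqn[of z] by simp
  qed
  have "\<exists>p. \<forall>i. line_holomorphic (p i) \<and> (\<forall>z. partial_deriv i u z = exp (p i z))"
    using line_holomorphic_log[OF ui nz] by (intro choice) blast
  then obtain p where p: "\<And>i. line_holomorphic (p i)" "\<And>i z. partial_deriv i u z = exp (p i z)"
    by blast
  have pd: "partial_deriv j (partial_deriv i u) z = exp (p i z) * partial_deriv j (p i) z" for i j z
  proof (rule partial_deriv_eqI)
    have "((\<lambda>w. exp (p i (z + axis j w))) has_field_derivative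
        exp (p i (z + axis j 0)) * partial_deriv j (p i) z) (at 0)"
      by (rule DERIV_fun_exp[OF partial_deriv_at[OF p(1)]])
    then show "((\<lambda>w. partial_deriv i u (z + axis j w)) has_field_derivative
        exp (p i z) * partial_deriv j (p i) z) (at 0)"
      by (simp add: p(2))
  qed
  have sep: "partial_deriv k (partial_deriv j u) z = 0" if "j \<in> J" "k \<noteq> j" for j k z
    using that by (simp add: J_def isolated_indices_def partial_deriv2_def)
  have p_iso: "p j x = p j y" if "j \<in> J" "x $ j = y $ j" for j and x y :: "complex ^ 'n"
    by (rule independent_of_coordinates[OF p(1), of "- {j}"]) (use that sep pd in auto)
  have p_link: "p i x = p i y" if "i \<in> X" "\<And>k. k \<in> X \<Longrightarrow> x $ k = y $ k" for i and x y :: "complex ^ 'n"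
  proof (rule independent_of_coordinates[OF p(1), of J])
    show "partial_deriv j (p i) z = 0" if "j \<in> J" for j z
      using sep[OF that, of i z] comm[of i j z] pd[of j i z] \<open>i \<in> X\<close> that XJ by auto
    show "x $ k = y $ k" if "k \<notin> J" for k
      using that XJ \<open>\<And>k. k \<in> X \<Longrightarrow> x $ k = y $ k\<close> by auto
  qed
  have adj: "adjacent u i j \<longleftrightarrow> (\<exists>z. partial_deriv j (p i) z \<noteq> 0)" for i j
    by (simp add: adjacent_def partial_deriv2_def pd)
  have symadj: "symp (adjacent u)"
    by (rule sympI) (use comm in \<open>auto simp: adjacent_def partial_deriv2_def\<close>)
  have adjX: "j \<in> X" if "i \<in> X" "adjacent u i j" for i j
  proof (cases "i = j")
    case False
    have "adjacent u j i" using sympD[OF symadj that(2)] .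
    then show ?thesis using False sep[of j i] XJ by (auto simp: adjacent_def partial_deriv2_def)
  qed (use that in simp)
  obtain B where B: "blocks u = {B}"
    using one unfolding num_blocks_def by (auto simp: card_1_singleton_iff)
  have XB: "X = B"
    using partition_onD1[OF blocks_partition(1)[OF symadj]] B by (simp add: X_def)
  have chainX: "chained u i j" if "i \<in> X" "j \<in> X" for i j
    using blocks_partition(3)[OF symadj, of B B i j] that B XB by simp
  have "card B \<ge> 2" by (rule blocks_partition(2)[OF symadj]) (simp add: B)
  then have "X \<noteq> {}" unfolding XB by force
  then obtain k\<^sub>0 where k0: "k\<^sub>0 \<in> X" by blast
  define E where "E = (\<lambda>i j. i \<in> X \<and> j \<in> X \<and> (\<exists>z. partial_deriv j (p i) z \<noteq> 0))"
  have conn: "E\<^sup>+\<^sup>+ i j" if "i \<in> X" "j \<in> X" for i j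
  proof -
    have "(adjacent u)\<^sup>+\<^sup>+ i j" using chainX[OF that] by (simp add: chained_def)
    then have "j \<in> X \<and> E\<^sup>+\<^sup>+ i j"
    proof (induction rule: tranclp_induct)
      case (base y)
      then show ?case using adjX[OF that(1)] that(1) adj by (auto simp: E_def)
    next
      case (step y z)
      then have "z \<in> X" using adjX by blast
      moreover have "E y z" using step adj \<open>z \<in> X\<close> by (auto simp: E_def)
      ultimately show ?case using step by auto
    qed
    then show ?thesis by simp
  qed

  have p_cont: "continuous_on S (p i)" for S i by (rule line_holomorphic_continuous[OF p(1)])
  obtain c0 where c0: "\<And>z. (\<Sum>i\<in>UNIV. p i z) = g z + c0"
  proof -
    have "(\<Sum>i\<in>UNIV. p i z) - g z = (\<Sum>i\<in>UNIV. p i 0) - g 0" for z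
    proof (rule exp_eq_1_imp_constant[of "\<lambda>z. (\<Sum>i\<in>UNIV. p i z) - g z"])
      show "continuous_on UNIV (\<lambda>z. (\<Sum>i\<in>UNIV. p i z) - g z)"
        by (intro continuous_intros p_cont continuous_polynomial[OF g])
      show "exp ((\<Sum>i\<in>UNIV. p i z) - g z) = 1" for z
        using eqn[of z] by (simp add: exp_diff exp_sum p(2))
    qed
    then have "(\<Sum>i\<in>UNIV. p i z) = g z + ((\<Sum>i\<in>UNIV. p i 0) - g 0)" for z
      by (metis add.commute diff_add_cancel)
    then show ?thesis using that by blast
  qed
  obtain C m where C: "C \<ge> 0" "\<And>z. norm (g z) \<le> C * (1 + norm z) ^ m"
    using norm_polynomial_le[OF g] by blast
  \<comment> \<open>the isolated \<open>p\<^sub>j\<close> depend on their own coordinate only and are constant once it is set to \<open>0\<close>\<close>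
  define c1 where "c1 = c0 - (\<Sum>j\<in>J. p j 0)"
  have sumX: "(\<Sum>i\<in>X. p i z) = g (coord_restrict X z) + c1" for z
  proof -
    let ?x = "coord_restrict X z"
    have "(\<Sum>i\<in>X. p i z) = (\<Sum>i\<in>X. p i ?x)"
      by (intro sum.cong refl p_link) auto
    also have "\<dots> = (\<Sum>i\<in>UNIV. p i ?x) - (\<Sum>j\<in>J. p j ?x)"
      by (simp add: XJ sum_diff)
    also have "(\<Sum>j\<in>J. p j ?x) = (\<Sum>j\<in>J. p j 0)"
      by (intro sum.cong refl p_iso) (auto simp: XJ)
    finally show ?thesis by (simp add: c0 c1_def)
  qed
  have growth: "norm (\<Sum>i\<in>X. p i z) \<le> (C + norm c1) * (1 + norm z) ^ m" for z
  proof -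
    have "norm (\<Sum>i\<in>X. p i z) \<le> C * (1 + norm (coord_restrict X z)) ^ m + norm c1"
      unfolding sumX by (intro order_trans[OF norm_triangle_ineq] add_mono C(2)) simp
    also have "\<dots> \<le> C * (1 + norm z) ^ m + norm c1 * (1 + norm z) ^ m"
      using C(1) norm_coord_restrict[of X z] one_le_power[of "1 + norm z" m]
      by (intro add_mono mult_left_mono power_mono) (auto simp: mult_le_cancel_left1)
    finally show ?thesis by (simp add: distrib_right)
  qed
  have "\<exists>c. \<forall>z. p i z - p k\<^sub>0 z = c" if "i \<in> X" for i
  proof (rule connected_logarithms_differ_by_constants[of X p, OF p(1) _ _ growth _ that k0])
    show "exp (p i z) * partial_deriv j (p i) z = exp (p j z) * partial_deriv i (p j) z" for i j z
      using comm[of j i z] by (simp add: pd)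
  qed (use conn C(1) in \<open>auto simp: E_def\<close>)
  then obtain d where d: "\<And>i z. i \<in> X \<Longrightarrow> p i z = p k\<^sub>0 z + d i"
    by (metis add.commute diff_add_cancel)

  have cardX: "of_nat (card X) \<noteq> (0 :: complex)"
    using k0 by (metis card_eq_0_iff emptyE finite of_nat_eq_0_iff)
  \<comment> \<open>the mean of the \<open>d i\<close> is subtracted to make the product of the \<open>A i\<close> equal to \<open>1\<close>\<close>
  define D where "D = (\<Sum>i\<in>X. d i) / of_nat (card X)"
  define A where "A = (\<lambda>i. exp (d i - D))"
  have A1: "(\<Prod>i\<in>X. A i) = 1"
    using cardX by (simp add: A_def exp_sum[symmetric] sum_subtractf D_def)
  have uA: "partial_deriv i u z = A i * exp (p k\<^sub>0 z + D)" if "i \<in> X" for i z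
    using d[OF that, of z] by (simp add: p(2) A_def exp_add[symmetric] algebra_simps)
  have A0: "A i \<noteq> 0" for i by (simp add: A_def)
  define L where "L = (\<lambda>z. \<Sum>i\<in>X. A i * z $ i)"
  define b where "b = axis k\<^sub>0 (1 / A k\<^sub>0)"
  \<comment> \<open>the derivative of \<open>u\<close> in a linked direction \<open>v\<close> is \<open>L v\<close> times the common factor of the \<open>u\<^sub>i\<close>\<close>
  have shift: "u (z + v) = u z" if v: "\<And>j. j \<in> J \<Longrightarrow> v $ j = 0" "L v = 0" for z v
  proof -
    have "((\<lambda>w. u (z + w *s v)) has_field_derivative 0) (at w within UNIV)" for w
    proof -
      let ?x = "z + w *s v"
      have "(\<Sum>i\<in>UNIV. v $ i * partial_deriv i u ?x) = (\<Sum>i\<in>X. v $ i * partial_deriv i u ?x)"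
        by (rule sum.mono_neutral_right) (use v XJ in auto)
      also have "\<dots> = L v * exp (p k\<^sub>0 ?x + D)"
        unfolding L_def sum_distrib_right by (rule sum.cong) (simp_all add: uA)
      finally show ?thesis using entire_directional_derivative[OF entire, of z v w] v(2) by simp
    qed
    then have "(\<lambda>w. u (z + w *s v)) constant_on UNIV"
      using has_field_derivative_zero_constant[OF convex_UNIV] unfolding constant_on_def by blast
    then have "u (z + 1 *s v) = u (z + 0 *s v)" unfolding constant_on_def by (metis UNIV_I)
    then show ?thesis by simp
  qed
  have Lb: "L (w *s b) = w" for w
  proof -
    have "L (w *s b) = (\<Sum>i\<in>X. if i = k\<^sub>0 then w else 0)"
      unfolding L_def b_def by (rule sum.cong) (use A0 in \<open>auto simp: axis_def\<close>)
    then show ?thesis using k0 by simp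
  qed
  have Ladd: "L (x + y) = L x + L y" for x y
    by (simp add: L_def distrib_left sum.distrib)
  have Ldiff: "L (x - y) = L x - L y" for x y
    using Ladd[of "x - y" y] by simp
  have bJ: "(w *s b) $ j = 0" if "j \<in> J" for j w
    using that k0 XJ by (auto simp: b_def axis_def)
  have reduce_diff: "L (z - (coord_restrict J z + L z *s b)) = 0"
      "j \<in> J \<Longrightarrow> (z - (coord_restrict J z + L z *s b)) $ j = 0" for z j
  proof -
    have "L (coord_restrict J z) = 0" unfolding L_def by (rule sum.neutral) (auto simp: XJ)
    then show "L (z - (coord_restrict J z + L z *s b)) = 0" by (simp add: Ldiff Ladd Lb)
  qed (use bJ in auto)
  have reduce: "u (x + z) = u (x + (coord_restrict J z + L z *s b))" for x z
    using shift[OF reduce_diff(2,1), of "x + (coord_restrict J z + L z *s b)" z] by simp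

  define f where "f = (\<lambda>w. u (w *s b))"
  define \<phi> where "\<phi> = (\<lambda>w. p k\<^sub>0 (w *s b) + D)"
  define h where "h = (\<lambda>j w. p j (axis j w))"
  define H where "H = (\<lambda>j w. u (axis j w) - u 0)"
  have u_eq: "u z = (\<Sum>j\<in>J. H j (z $ j)) + f (L z)" for z
    using reduce[of 0 z] split_off_separated_coordinates[OF u sep bJ, of J z "L z"]
    by (simp add: H_def f_def)
  have \<phi>_eq: "exp (p k\<^sub>0 z + D) = exp (\<phi> (L z))" for z
  proof -
    have "partial_deriv k\<^sub>0 u z = partial_deriv k\<^sub>0 u (coord_restrict J z + L z *s b)"
      unfolding partial_deriv_def using reduce[of "axis k\<^sub>0 _" z] by (simp add: add.commute)
    also have "\<dots> = partial_deriv k\<^sub>0 u (L z *s b)"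
    proof -
      have "p k\<^sub>0 (coord_restrict J z + L z *s b) = p k\<^sub>0 (L z *s b)"
        by (rule p_link[OF k0]) (auto simp: XJ)
      then show ?thesis by (simp add: p(2))
    qed
    finally show ?thesis using uA[OF k0] A0[of k\<^sub>0] by (simp add: \<phi>_def)
  qed
  have f_deriv: "(f has_field_derivative exp (\<phi> w)) (at w)" for w
  proof -
    have "(\<Sum>i\<in>UNIV. b $ i * partial_deriv i u (w *s b)) =
        (\<Sum>i\<in>UNIV. if i = k\<^sub>0 then 1 / A k\<^sub>0 * partial_deriv k\<^sub>0 u (w *s b) else 0)"
      by (rule sum.cong) (auto simp: b_def axis_def)
    also have "\<dots> = exp (\<phi> w)" using A0[of k\<^sub>0] by (simp add: uA[OF k0] \<phi>_def)
    finally show ?thesis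
      using entire_directional_derivative[OF entire, of 0 b w] by (simp add: f_def)
  qed
  have \<phi>_hol: "\<phi> holomorphic_on UNIV"
    unfolding \<phi>_def using line_holomorphic_line[OF p(1)[of k\<^sub>0], of 0 b UNIV]
    by (simp add: holomorphic_on_add)
  have f_hol: "f holomorphic_on UNIV"
    unfolding f_def using line_holomorphic_line[OF u, of 0 b UNIV] by simp
  have h_hol: "h j holomorphic_on UNIV" for j
    unfolding h_def using line_holomorphic_axis[OF p(1)[of j], of 0 j UNIV] by simp
  have H_hol: "H j holomorphic_on UNIV" for j
    unfolding H_def using line_holomorphic_axis[OF u, of 0 j UNIV] by (simp add: holomorphic_on_diff)
  have H_deriv: "deriv (H j) w = exp (h j w)" for j w
  proof (rule DERIV_imp_deriv)
    show "(H j has_field_derivative exp (h j w)) (at w)"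
      using DERIV_diff[OF partial_deriv_axis[OF u, of 0 j w] DERIV_const[of "u 0"]]
      by (simp add: H_def h_def p(2))
  qed

  define S where "S = (\<lambda>z. (\<Sum>j\<in>J. h j (z $ j)) + of_nat (card X) * \<phi> (L z))"
  have expS: "exp (g z - S z) = 1" for z
  proof -
    have "exp (g z) = (\<Prod>j\<in>J. partial_deriv j u z) * (\<Prod>i\<in>X. partial_deriv i u z)"
      unfolding eqn[symmetric] XJ by (subst prod.subset_diff[of J UNIV]) (auto simp: mult.commute)
    also have "(\<Prod>j\<in>J. partial_deriv j u z) = exp (\<Sum>j\<in>J. h j (z $ j))"
    proof -
      have "p j z = h j (z $ j)" if "j \<in> J" for j
        unfolding h_def by (rule p_iso[OF that]) simp
      then show ?thesis by (simp add: p(2) exp_sum)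
    qed
    also have "(\<Prod>i\<in>X. partial_deriv i u z) = exp (of_nat (card X) * \<phi> (L z))"
      by (simp add: uA prod.distrib A1 \<phi>_eq exp_of_nat_mult)
    finally show ?thesis by (simp add: S_def exp_diff exp_add)
  qed
  have L_cont: "continuous_on UNIV L"
    unfolding L_def by (intro continuous_intros)
  have S_cont: "continuous_on UNIV S"
    unfolding S_def
  proof (intro continuous_intros)
    show "continuous_on UNIV (\<lambda>z. h j (z $ j))" for j
      by (rule continuous_on_compose2[OF holomorphic_on_imp_continuous_on[OF h_hol]])
         (auto intro!: continuous_intros)
    show "continuous_on UNIV (\<lambda>z. \<phi> (L z))"
      by (rule continuous_on_compose2[OF holomorphic_on_imp_continuous_on[OF \<phi>_hol] L_cont]) auto
  qed
  have gS: "g z - S z = g 0 - S 0" for z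
    by (rule exp_eq_1_imp_constant[of "\<lambda>z. g z - S z"])
       (intro continuous_on_diff continuous_polynomial[OF g] S_cont expS)+
  obtain k :: int where k: "g 0 - S 0 = 2 * of_int k * of_real pi * \<i>"
  proof -
    obtain k :: int where "Re (g 0 - S 0) = 0" "Im (g 0 - S 0) = of_int (2 * k) * pi"
      using expS[of 0] unfolding exp_eq_1 by blast
    then have "g 0 - S 0 = 2 * of_int k * of_real pi * \<i>" by (simp add: complex_eq_iff)
    then show ?thesis using that by blast
  qed
  have g_eq: "g z = S z + 2 * of_int k * of_real pi * \<i>" for z
    using gS[of z] unfolding k by (simp add: algebra_simps)
  show ?thesis
    by (rule that[OF A1 \<phi>_hol f_hol f_deriv h_hol H_hol H_deriv g_eq[unfolded S_def L_def] u_eq[unfolded L_def]])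
qed

section \<open>The two cases\<close>

text \<open>
  In the first case the leftover \<open>2k\<pi>i\<close> must be absorbed into \<open>G\<close>. Doing so multiplies
  \<open>exp (G/n)\<close> by an \<open>n\<close>-th root of unity, which is compensated by multiplying all \<open>A\<^sub>i\<close> with the
  inverse root; their product remains \<open>1\<close>. The second case only renames indices along \<open>\<tau>\<close>.
\<close>
theorem corollary1:
  fixes g u :: "complex ^ 'n \<Rightarrow> complex"
  assumes "polynomial_cn g"
    and "entire_cn u"
    and "\<forall>z. (\<Prod>i\<in>UNIV. partial_deriv i u z) = exp (g z)"
  shows
    "(card (isolated_indices u) = 0 \<and> num_blocks u = 1 \<longrightarrow>
       (\<exists>(A :: 'n \<Rightarrow> complex) (G :: complex \<Rightarrow> complex) (f :: complex \<Rightarrow> complex).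
          (\<Prod>i\<in>UNIV. A i) = 1 \<and>
          G holomorphic_on UNIV \<and> f holomorphic_on UNIV \<and>
          (\<forall>w. deriv f w = exp (G w / of_nat CARD('n))) \<and>
          (\<forall>z. g z = G (\<Sum>i\<in>UNIV. A i * z $ i)) \<and>
          (\<forall>z. u z = f (\<Sum>i\<in>UNIV. A i * z $ i))))
     \<and>
     (\<forall>(\<nu> :: nat) (\<tau> :: nat \<Rightarrow> 'n).
       \<nu> = card (isolated_indices u) \<and> 0 < \<nu> \<and> \<nu> < CARD('n) \<and>
       bij_betw \<tau> {1..CARD('n)} UNIV \<and>
       isolated_indices u = \<tau> ` {1..\<nu>} \<and>
       linked_indices u = \<tau> ` {\<nu>+1..CARD('n)} \<and>
       num_blocks u = 1 \<longrightarrow>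
       (\<exists>(h :: nat \<Rightarrow> complex \<Rightarrow> complex) (H :: nat \<Rightarrow> complex \<Rightarrow> complex)
          (f :: complex \<Rightarrow> complex) (A :: 'n \<Rightarrow> complex) (k\<^sub>0 :: int).
          (\<forall>i\<in>{1..\<nu>+1}. h i holomorphic_on UNIV) \<and> f holomorphic_on UNIV \<and>
          (\<forall>w. deriv f w = exp (h (\<nu>+1) w / of_nat (CARD('n) - \<nu>))) \<and>
          (\<forall>i\<in>{1..\<nu>}. H i holomorphic_on UNIV \<and> (\<forall>w. deriv (H i) w = exp (h i w))) \<and>
          (\<forall>z. g z = (\<Sum>i=1..\<nu>. h i (z $ \<tau> i))
                     + h (\<nu>+1) (\<Sum>j=\<nu>+1..CARD('n). A (\<tau> j) * z $ \<tau> j)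
                     + 2 * of_int k\<^sub>0 * of_real pi * \<i>) \<and>
          (\<forall>z. u z = (\<Sum>i=1..\<nu>. H i (z $ \<tau> i))
                     + f (\<Sum>j=\<nu>+1..CARD('n). A (\<tau> j) * z $ \<tau> j))))"
proof (intro conjI impI allI)
  assume *: "card (isolated_indices u) = 0 \<and> num_blocks u = 1"
  then have J: "isolated_indices u = {}" and X: "linked_indices u = UNIV"
    by (simp_all add: linked_indices_def)
  obtain A :: "'n \<Rightarrow> complex" and \<phi> f and k :: int
    where A: "(\<Prod>i\<in>UNIV. A i) = 1" and \<phi>: "\<phi> holomorphic_on UNIV" and f: "f holomorphic_on UNIV"
      and f': "\<And>w. (f has_field_derivative exp (\<phi> w)) (at w)"
      and g: "\<And>z. g z = of_nat CARD('n) * \<phi> (\<Sum>i\<in>UNIV. A i * z $ i) + 2 * of_int k * of_real pi * \<i>"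
      and u: "\<And>z. u z = f (\<Sum>i\<in>UNIV. A i * z $ i)"
    by (rule one_block_structure[OF assms(1,2) spec[OF assms(3)] conjunct2[OF *]])
       (auto simp: J X)
  define N where "N = CARD('n)"
  have N: "N > 0" by (simp add: N_def)
  \<comment> \<open>\<open>1 / \<omega>\<close> is the factor that adding \<open>2k\<pi>i\<close> to \<open>G\<close> contributes to \<open>exp (G / n)\<close>\<close>
  define \<omega> where "\<omega> = exp (- (2 * of_int k * of_real pi * \<i> / of_nat N))"
  have \<omega>0: "\<omega> \<noteq> 0" by (simp add: \<omega>_def)
  have "\<omega> ^ N = exp (of_nat N * - (2 * of_int k * of_real pi * \<i> / of_nat N))"
    unfolding \<omega>_def by (rule exp_of_nat_mult[symmetric])
  also have "\<dots> = exp (2 * of_int (- k) * of_real pi * \<i>)" using N by simp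
  also have "\<dots> = 1" unfolding exp_eq_1 by (auto intro: exI[of _ "- k"])
  finally have \<omega>N: "\<omega> ^ N = 1" .
  have scale: "(\<Sum>i\<in>UNIV. \<omega> * A i * z $ i) / \<omega> = (\<Sum>i\<in>UNIV. A i * z $ i)" for z :: "complex ^ 'n"
    using \<omega>0 by (simp add: mult.assoc flip: sum_distrib_left)
  define G where "G = (\<lambda>w. of_nat N * \<phi> (w / \<omega>) + 2 * of_int k * of_real pi * \<i>)"
  define F where "F = (\<lambda>w. f (w / \<omega>))"
  have hol: "(\<lambda>w. q (w / \<omega>)) holomorphic_on UNIV" if "q holomorphic_on UNIV" for q
    using holomorphic_on_compose_gen[of "\<lambda>w. w / \<omega>" UNIV q UNIV] that \<omega>0
    by (simp add: o_def holomorphic_intros)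
  show "\<exists>A G f. (\<Prod>i\<in>UNIV. A i) = 1 \<and> G holomorphic_on UNIV \<and> f holomorphic_on UNIV \<and>
      (\<forall>w. deriv f w = exp (G w / of_nat CARD('n))) \<and>
      (\<forall>z. g z = G (\<Sum>i\<in>UNIV. A i * z $ i)) \<and> (\<forall>z. u z = f (\<Sum>i\<in>UNIV. A i * z $ i))"
  proof (rule exI[of _ "\<lambda>i. \<omega> * A i"], rule exI[of _ G], rule exI[of _ F], intro conjI allI)
    show "(\<Prod>i\<in>UNIV. \<omega> * A i) = 1" using \<omega>N by (simp add: prod.distrib A N_def)
    show "G holomorphic_on UNIV" unfolding G_def by (intro holomorphic_intros hol \<phi>)
    show "F holomorphic_on UNIV" unfolding F_def by (intro hol f)
    show "deriv F w = exp (G w / of_nat CARD('n))" for w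
    proof (rule DERIV_imp_deriv)
      have "((\<lambda>w. w / \<omega>) has_field_derivative 1 / \<omega>) (at w)"
        by (rule DERIV_cdivide[OF DERIV_ident])
      from DERIV_chain2[OF f' this]
      have "(F has_field_derivative exp (\<phi> (w / \<omega>)) * (1 / \<omega>)) (at w)" by (simp add: F_def)
      also have "1 / \<omega> = exp (2 * of_int k * of_real pi * \<i> / of_nat N)"
        by (simp add: \<omega>_def exp_minus inverse_eq_divide)
      also have "exp (\<phi> (w / \<omega>)) * \<dots> = exp (G w / of_nat CARD('n))"
        using N by (simp add: G_def add_divide_distrib exp_add flip: N_def)
      finally show "(F has_field_derivative exp (G w / of_nat CARD('n))) (at w)" .
    qed
    show "g z = G (\<Sum>i\<in>UNIV. \<omega> * A i * z $ i)" for z by (simp add: G_def scale g N_def)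
    show "u z = F (\<Sum>i\<in>UNIV. \<omega> * A i * z $ i)" for z by (simp add: F_def scale u)
  qed
next
  fix \<nu> :: nat and \<tau> :: "nat \<Rightarrow> 'n"
  assume *: "\<nu> = card (isolated_indices u) \<and> 0 < \<nu> \<and> \<nu> < CARD('n) \<and>
       bij_betw \<tau> {1..CARD('n)} UNIV \<and>
       isolated_indices u = \<tau> ` {1..\<nu>} \<and>
       linked_indices u = \<tau> ` {\<nu>+1..CARD('n)} \<and>
       num_blocks u = 1"
  then have J: "isolated_indices u = \<tau> ` {1..\<nu>}" and X: "linked_indices u = \<tau> ` {\<nu>+1..CARD('n)}"
    and one: "num_blocks u = 1" and \<nu>: "\<nu> < CARD('n)" and inj: "inj_on \<tau> {1..CARD('n)}"
    by (blast intro: bij_betw_imp_inj_on)+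
  have injJ: "inj_on \<tau> {1..\<nu>}" and injX: "inj_on \<tau> {\<nu>+1..CARD('n)}"
    using \<nu> by (auto intro: inj_on_subset[OF inj])
  have cardX: "card (linked_indices u) = CARD('n) - \<nu>"
    unfolding X card_image[OF injX] by simp
  obtain A :: "'n \<Rightarrow> complex" and \<phi> f and h H :: "'n \<Rightarrow> complex \<Rightarrow> complex" and k :: int
    where A: "\<phi> holomorphic_on UNIV" "f holomorphic_on UNIV"
      "\<And>w. (f has_field_derivative exp (\<phi> w)) (at w)"
      and h: "\<And>j. j \<in> isolated_indices u \<Longrightarrow> h j holomorphic_on UNIV"
      and H: "\<And>j. j \<in> isolated_indices u \<Longrightarrow> H j holomorphic_on UNIV"
      "\<And>j w. j \<in> isolated_indices u \<Longrightarrow> deriv (H j) w = exp (h j w)"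
      and g: "\<And>z. g z = (\<Sum>j\<in>isolated_indices u. h j (z $ j))
            + of_nat (card (linked_indices u)) * \<phi> (\<Sum>i\<in>linked_indices u. A i * z $ i)
            + 2 * of_int k * of_real pi * \<i>"
      and u: "\<And>z. u z = (\<Sum>j\<in>isolated_indices u. H j (z $ j))
            + f (\<Sum>i\<in>linked_indices u. A i * z $ i)"
    by (rule one_block_structure[OF assms(1,2) spec[OF assms(3)] one]) blast
  define h' where "h' = (\<lambda>i. if i \<le> \<nu> then h (\<tau> i) else (\<lambda>w. of_nat (CARD('n) - \<nu>) * \<phi> w))"
  have sumX: "(\<Sum>i\<in>linked_indices u. A i * z $ i) = (\<Sum>j=\<nu>+1..CARD('n). A (\<tau> j) * z $ \<tau> j)" for z
    unfolding X sum.reindex[OF injX] by simp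
  have sumJ: "(\<Sum>j\<in>isolated_indices u. q j) = (\<Sum>i=1..\<nu>. q (\<tau> i))" for q :: "'n \<Rightarrow> complex"
    unfolding J sum.reindex[OF injJ] by simp
  show "\<exists>h H f A (k\<^sub>0 :: int).
          (\<forall>i\<in>{1..\<nu>+1}. h i holomorphic_on UNIV) \<and> f holomorphic_on UNIV \<and>
          (\<forall>w. deriv f w = exp (h (\<nu>+1) w / of_nat (CARD('n) - \<nu>))) \<and>
          (\<forall>i\<in>{1..\<nu>}. H i holomorphic_on UNIV \<and> (\<forall>w. deriv (H i) w = exp (h i w))) \<and>
          (\<forall>z. g z = (\<Sum>i=1..\<nu>. h i (z $ \<tau> i))
                     + h (\<nu>+1) (\<Sum>j=\<nu>+1..CARD('n). A (\<tau> j) * z $ \<tau> j)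
                     + 2 * of_int k\<^sub>0 * of_real pi * \<i>) \<and>
          (\<forall>z. u z = (\<Sum>i=1..\<nu>. H i (z $ \<tau> i))
                     + f (\<Sum>j=\<nu>+1..CARD('n). A (\<tau> j) * z $ \<tau> j))"
  proof (rule exI[of _ h'], rule exI[of _ "\<lambda>i. H (\<tau> i)"], rule exI[of _ f], rule exI[of _ A],
      rule exI[of _ k], intro conjI allI ballI)
    show "h' i holomorphic_on UNIV" if "i \<in> {1..\<nu>+1}" for i
      using that h[of "\<tau> i"] A(1) by (auto simp: h'_def J intro!: holomorphic_intros)
    show "deriv f w = exp (h' (\<nu>+1) w / of_nat (CARD('n) - \<nu>))" for w
    proof -
      have "of_nat (CARD('n) - \<nu>) \<noteq> (0 :: complex)" using \<nu> by simp
      then show ?thesis using DERIV_imp_deriv[OF A(3)] by (simp add: h'_def)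
    qed
    show "g z = (\<Sum>i=1..\<nu>. h' i (z $ \<tau> i)) + h' (\<nu>+1) (\<Sum>j=\<nu>+1..CARD('n). A (\<tau> j) * z $ \<tau> j)
        + 2 * of_int k * of_real pi * \<i>" for z
      unfolding g[of z] sumJ sumX cardX by (simp add: h'_def)
    show "u z = (\<Sum>i=1..\<nu>. H (\<tau> i) (z $ \<tau> i)) + f (\<Sum>j=\<nu>+1..CARD('n). A (\<tau> j) * z $ \<tau> j)" for z
      unfolding u[of z] sumJ sumX by simp
  qed (use A(2) H in \<open>auto simp: J h'_def\<close>)
qed

end
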